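(* The same closed elementary formulas with parameters in $\mathcal M$ are realized in the models $\mathcal N_{\mathcal A}$ and $\mathcal N_{\mathcal B}$.
   Context: $\mathcal A$ is a coherent realizability algebra (terms $\Lambda$, stacks $\Pi$, instructions $B,C,I,K,W,\mathrm{cc}$, continuations $k_\pi$, execution $\succ$ given by $(\xi)\eta\star\pi\succ\xi\star\eta\cdot\pi$, $I\star\xi\cdot\pi\succ\xi\star\pi$, $K\star\xi\cdot\eta\cdot\pi\succ\xi\star\pi$, $W\star\xi\cdot\eta\cdot\pi\succ\xi\star\eta\cdot\eta\cdot\pi$, $C\star\xi\cdot\eta\cdot\zeta\cdot\pi\succ\xi\star\zeta\cdot\eta\cdot\pi$, $B\star\xi\cdot\eta\cdot\zeta\cdot\pi\succ\xi\star(\eta)\zeta\cdot\pi$, $\mathrm{cc}\star\xi\cdot\pi\succ\xi\star k_\pi\cdot\pi$, $k_\pi\star\xi\cdot\varpi\succ\xi\star\pi$; set $\perp\!\!\!\perp$ closed under anti-execution; proof-like terms QP) in a ground model $\mathcal M\models$ ZF+$V=L$. For any realizability algebra, its realizability model over $\mathcal M$ has the individuals of $\mathcal M$, falsity values $\|\top\|=\emptyset$, $\|\bot\|=$ all stacks, $\|A\to B\|=\{\xi\cdot\pi:\xi\Vdash A,\pi\in\|B\|\}$, $\|\forall xA\|=\bigcup_a\|A[a/x]\|$, $\|t=u\hookrightarrow F\|=\|F\|$ if $t=u$ in $\mathcal M$ and $\emptyset$ otherwise, $\|\forall n^{\mathrm{int}}F[n]\|=\{\underline n\cdot\pi:n\in\mathbb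 N,\pi\in\|F[n]\|\}$ where $\underline n$ is the integer $n$ of the algebra ($\underline0=KI$, $\underline{n+1}=(\sigma)\underline n$, $\sigma=(BW)(B)B$), and $\xi\Vdash F$ iff $\xi\star\pi\in\perp\!\!\!\perp$ for all $\pi\in\|F\|$; $F$ is realized if some proof-like term realizes it. $\mathcal B$ is built as follows: $\kappa$ an infinite cardinal of $\mathcal M$, $\kappa\ge\mathrm{card}(\Lambda\cup\Pi)$; $P=\kappa^{<\omega}\cup\{\mathbf0\}$, $\mathbf1=\emptyset$, $pq$ equal to the larger of $p,q$ if both $\ne\mathbf0$ and comparable under inclusion, $\mathbf0$ otherwise; terms $\Lambda\times P$, stacks $\Pi\times P$, $(\xi,p)\cdot(\pi,q)=(\xi\cdot\pi,pq)$, $(\xi,p)\star(\pi,q)=(\xi\star\pi,pq)$, $(\xi,p)(\eta,q)=(C\xi\eta,pq)$; instructions $(B^*,\mathbf1),(C^*,\mathbf1),(I^*,\mathbf1),(K^*,\mathbf1),(W^*,\mathbf1),(\mathrm{cc}^*,\mathbf1)$ with $B^*=\lambda n\lambda x\lambda y\lambda z(xn)(C)yz$, $C^*=(C)(B)C$, $I^*=CI$, $K^*=(C)(B)K$, $W^*=(C)(B)W$, $\mathrm{cc}^*=\lambda n\lambda x(\mathrm{cc})\lambda k(xn)\lambda n\lambda x(k)(x)n$; continuations $k_{(\pi,p)}=((C)(B)k_\pi,p)$; $(\xi\star\pi,p)\in\perp\!\!\!\perp_{\mathcal B}$ iff $\xi\star\underline n\cdot\pi\in\perp\!\!\!\perp$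 for every $n$ with $p\neq\mathbf0$, $\mathrm{dom}(p)\le n$; proof-like terms $(\theta,\mathbf1)$ with $\theta\in$ QP. Elementary formulas: $\top,\bot$ are elementary; if $U,V$ are elementary then so are $t=u\hookrightarrow U$, $\forall x\,U$, $U\to V$ and $\forall n^{\mathrm{int}}U$, where $t,u$ are terms built from variables, individuals of $\mathcal M$ and function symbols defined in $\mathcal M$ (interpreted as in $\mathcal M$). *)

theory Defs
  imports Main
begin

section \<open>Combinatory terms and abstraction\<close>

datatype cterm =
  CVar nat | CB | CC | CI | CK | CW | Ccc | CApp cterm cterm (infixl "\<cdot>" 100)

primrec occurs :: "nat \<Rightarrow> cterm \<Rightarrow> bool" where
  "occurs x (CVar y) = (x = y)"
| "occurs x CB = False"
| "occurs x CC = False"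
| "occurs x CI = False"
| "occurs x CK = False"
| "occurs x CW = False"
| "occurs x Ccc = False"
| "occurs x (t \<cdot> u) = (occurs x t \<or> occurs x u)"

text \<open>
  The translation of \<open>\<lambda>x. t\<close> takes the first applicable rule of:
  \<open>\<lambda>x. t = K t\<close> (\<open>x\<close> not in \<open>t\<close>); \<open>\<lambda>x. x = I\<close>; \<open>\<lambda>x. t u = C (\<lambda>x. t) u\<close> (\<open>x\<close> not in \<open>u\<close>);
  \<open>\<lambda>x. t x = t\<close> (\<open>x\<close> not in \<open>t\<close>); \<open>\<lambda>x. t x = W (\<lambda>x. t)\<close>; \<open>\<lambda>x. t (u v) = \<lambda>x. B t u v\<close>.
  With these rules \<open>\<lambda>n. \<lambda>x. k (x n)\<close> is literally \<open>C (B k)\<close>, the shape of the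
  continuations of the extended algebra below.
\<close>

function abstr :: "nat \<Rightarrow> cterm \<Rightarrow> cterm" where
  "abstr x t =
    (if \<not> occurs x t then CK \<cdot> t
     else case t of
       t1 \<cdot> u \<Rightarrow>
         (if \<not> occurs x u then CC \<cdot> abstr x t1 \<cdot> u
          else case u of
            u1 \<cdot> v \<Rightarrow> abstr x (CB \<cdot> t1 \<cdot> u1 \<cdot> v)
          | _ \<Rightarrow> (if \<not> occurs x t1 then t1 else CW \<cdot> abstr x t1))
     | _ \<Rightarrow> CI)"
  by auto

text \<open>
  The last rule may enlarge the term. It lowers \<open>abstr_joins\<close> if \<open>x\<close> occurs in \<open>t\<close>;
  otherwise it only shortens the last argument.
\<close>

fun abstr_nodes :: "nat \<Rightarrow> cterm \<Rightarrow> nat" where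
  "abstr_nodes x (t \<cdot> u) =
    (if occurs x t \<or> occurs x u then Suc (abstr_nodes x t + abstr_nodes x u) else 0)"
| "abstr_nodes x _ = 0"

fun abstr_joins :: "nat \<Rightarrow> cterm \<Rightarrow> nat" where
  "abstr_joins x (t \<cdot> u) =
    abstr_joins x t + abstr_joins x u +
    (if occurs x t \<and> occurs x u then abstr_nodes x u else 0)"
| "abstr_joins x _ = 0"

lemma abstr_nodes_0: "\<not> occurs x t \<Longrightarrow> abstr_nodes x t = 0"
  by (cases t) auto

lemma abstr_joins_0: "\<not> occurs x t \<Longrightarrow> abstr_joins x t = 0"
  by (induction t) auto

termination abstr
  by (relation "measures [\<lambda>(x, t). abstr_joins x t, \<lambda>(x, t). abstr_nodes x t,
        \<lambda>(x, t). case t of _ \<cdot> u \<Rightarrow> size u | _ \<Rightarrow> 0]")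
     (auto simp: abstr_nodes_0 abstr_joins_0)

declare abstr.simps [simp del]

text \<open>
  With \<open>n, x, y, z, k\<close> numbered \<open>0\<close> to \<open>4\<close>:
  \<open>B\<^sup>* = \<lambda>n x y z. (x n) (C y z)\<close> and \<open>cc\<^sup>* = \<lambda>n x. cc (\<lambda>k. (x n) (\<lambda>n x. k (x n)))\<close>.
\<close>

definition B_star :: cterm where
  "B_star = abstr 0 (abstr 1 (abstr 2 (abstr 3
    ((CVar 1 \<cdot> CVar 0) \<cdot> (CC \<cdot> CVar 2 \<cdot> CVar 3)))))"

definition C_star :: cterm where
  "C_star = CC \<cdot> (CB \<cdot> CC)"

definition I_star :: cterm where
  "I_star = CC \<cdot> CI"

definition K_star :: cterm where
  "K_star = CC \<cdot> (CB \<cdot> CK)"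

definition W_star :: cterm where
  "W_star = CC \<cdot> (CB \<cdot> CW)"

definition cc_star :: cterm where
  "cc_star = abstr 0 (abstr 1 (Ccc \<cdot> abstr 4
    ((CVar 1 \<cdot> CVar 0) \<cdot> abstr 0 (abstr 1 (CVar 4 \<cdot> (CVar 1 \<cdot> CVar 0))))))"


section \<open>Formulas\<close>

datatype set_formula =
  Mem nat nat | Eq nat nat | Neg set_formula | And set_formula set_formula
| Forall nat set_formula

datatype 'm fterm =
  Var nat | Ind 'm | Fun "'m list \<Rightarrow> 'm" "'m fterm list"

datatype 'm elementary =
  Top | Bot
| EqImp "'m fterm" "'m fterm" "'m elementary"
| Univ nat "'m elementary"
| Imp "'m elementary" "'m elementary"
| ForallInt nat "'m elementary"

primrec fterm_vars :: "'m fterm \<Rightarrow> nat set" where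
  "fterm_vars (Var x) = {x}"
| "fterm_vars (Ind a) = {}"
| "fterm_vars (Fun f ts) = \<Union> (set (map fterm_vars ts))"

primrec free_vars :: "'m elementary \<Rightarrow> nat set" where
  "free_vars Top = {}"
| "free_vars Bot = {}"
| "free_vars (EqImp t u F) = fterm_vars t \<union> fterm_vars u \<union> free_vars F"
| "free_vars (Univ x F) = free_vars F - {x}"
| "free_vars (Imp F G) = free_vars F \<union> free_vars G"
| "free_vars (ForallInt x F) = free_vars F - {x}"

primrec fterm_val :: "(nat \<Rightarrow> 'm) \<Rightarrow> 'm fterm \<Rightarrow> 'm" where
  "fterm_val e (Var x) = e x"
| "fterm_val e (Ind a) = a"
| "fterm_val e (Fun f ts) = f (map (fterm_val e) ts)"


section \<open>The ground model\<close>

text \<open>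
  The ground model is the structure \<open>('m, \<epsilon>)\<close>, which need be neither well-founded nor have
  standard integers. Except in the two axiom schemes, which range over \<open>set_formula\<close>, quantifiers
  range over individuals only, so that each definition below down to \<open>cardinal_le\<close> is the
  interpretation in \<open>('m, \<epsilon>)\<close> of a first-order formula.
\<close>

locale set_structure =
  fixes mem :: "'m \<Rightarrow> 'm \<Rightarrow> bool" (infix "\<epsilon>" 50)
begin

definition subset_of :: "'m \<Rightarrow> 'm \<Rightarrow> bool" where
  "subset_of a b \<longleftrightarrow> (\<forall>x. x \<epsilon> a \<longrightarrow> x \<epsilon> b)"

definition set_of :: "('m \<Rightarrow> bool) \<Rightarrow> 'm" where
  "set_of P = (THE a. \<forall>x. x \<epsilon> a \<longleftrightarrow> P x)"

definition empty :: 'm where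
  "empty = set_of (\<lambda>x. False)"

definition upair :: "'m \<Rightarrow> 'm \<Rightarrow> 'm" where
  "upair a b = set_of (\<lambda>x. x = a \<or> x = b)"

definition opair :: "'m \<Rightarrow> 'm \<Rightarrow> 'm" where
  "opair a b = upair (upair a a) (upair a b)"

definition union :: "'m \<Rightarrow> 'm \<Rightarrow> 'm" where
  "union a b = set_of (\<lambda>x. x \<epsilon> a \<or> x \<epsilon> b)"

definition cprod :: "'m \<Rightarrow> 'm \<Rightarrow> 'm" where
  "cprod a b = set_of (\<lambda>z. \<exists>x y. x \<epsilon> a \<and> y \<epsilon> b \<and> z = opair x y)"

definition succ :: "'m \<Rightarrow> 'm" where
  "succ a = union a (upair a a)"

definition is_inductive :: "'m \<Rightarrow> bool" where
  "is_inductive a \<longleftrightarrow> empty \<epsilon> a \<and> (\<forall>x. x \<epsilon> a \<longrightarrow> succ x \<epsilon> a)"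

definition omega :: 'm where
  "omega = set_of (\<lambda>n. \<forall>a. is_inductive a \<longrightarrow> n \<epsilon> a)"

definition func :: "'m \<Rightarrow> 'm \<Rightarrow> 'm \<Rightarrow> bool" where
  "func f a b \<longleftrightarrow>
    (\<forall>z. z \<epsilon> f \<longrightarrow> (\<exists>x y. x \<epsilon> a \<and> y \<epsilon> b \<and> z = opair x y)) \<and>
    (\<forall>x. x \<epsilon> a \<longrightarrow> (\<exists>!y. opair x y \<epsilon> f))"

definition func_on :: "'m \<Rightarrow> 'm \<Rightarrow> bool" where
  "func_on f a \<longleftrightarrow> (\<exists>b. func f a b)"

definition fapply :: "'m \<Rightarrow> 'm \<Rightarrow> 'm" where
  "fapply f x = (THE y. opair x y \<epsilon> f)"

definition dom :: "'m \<Rightarrow> 'm" where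
  "dom f = set_of (\<lambda>x. \<exists>y. opair x y \<epsilon> f)"

subsection \<open>ZF\<close>

primrec sat :: "(nat \<Rightarrow> 'm) \<Rightarrow> set_formula \<Rightarrow> bool" where
  "sat e (Mem i j) \<longleftrightarrow> e i \<epsilon> e j"
| "sat e (Eq i j) \<longleftrightarrow> e i = e j"
| "sat e (Neg \<phi>) \<longleftrightarrow> \<not> sat e \<phi>"
| "sat e (And \<phi> \<psi>) \<longleftrightarrow> sat e \<phi> \<and> sat e \<psi>"
| "sat e (Forall i \<phi>) \<longleftrightarrow> (\<forall>a. sat (e(i := a)) \<phi>)"

definition ZF :: bool where
  "ZF \<longleftrightarrow>
    (\<forall>a b. (\<forall>x. x \<epsilon> a \<longleftrightarrow> x \<epsilon> b) \<longrightarrow> a = b) \<and>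
    (\<forall>a. (\<exists>x. x \<epsilon> a) \<longrightarrow> (\<exists>x. x \<epsilon> a \<and> (\<forall>y. y \<epsilon> x \<longrightarrow> \<not> y \<epsilon> a))) \<and>
    (\<forall>a b. \<exists>c. \<forall>x. x \<epsilon> c \<longleftrightarrow> x = a \<or> x = b) \<and>
    (\<forall>a. \<exists>c. \<forall>x. x \<epsilon> c \<longleftrightarrow> (\<exists>y. y \<epsilon> a \<and> x \<epsilon> y)) \<and>
    (\<forall>a. \<exists>c. \<forall>x. x \<epsilon> c \<longleftrightarrow> subset_of x a) \<and>
    (\<exists>a. is_inductive a) \<and>
    (\<forall>\<phi> e a. \<exists>c. \<forall>x. x \<epsilon> c \<longleftrightarrow> x \<epsilon> a \<and> sat (e(0 := x)) \<phi>) \<and>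
    (\<forall>\<phi> e a. (\<forall>x. x \<epsilon> a \<longrightarrow> (\<exists>!y. sat (e(0 := x, 1 := y)) \<phi>)) \<longrightarrow>
      (\<exists>c. \<forall>y. y \<epsilon> c \<longleftrightarrow> (\<exists>x. x \<epsilon> a \<and> sat (e(0 := x, 1 := y)) \<phi>)))"

subsection \<open>Constructibility\<close>

text \<open>
  Definability over \<open>a\<close> is expressed inside the model: the definable relations on \<open>a\<close> of arity
  \<open>n\<close>, i.e. sets of functions from \<open>n\<close> to \<open>a\<close>, are the least family that contains the membership
  and equality relations between coordinates and is closed under complement, intersection and
  projection along the last coordinate.
\<close>

definition def_closed :: "'m \<Rightarrow> 'm \<Rightarrow> bool" where
  "def_closed a D \<longleftrightarrow> func_on D omega \<and>
    (\<forall>n. n \<epsilon> omega \<longrightarrow>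
      (\<forall>i j. i \<epsilon> n \<and> j \<epsilon> n \<longrightarrow>
        set_of (\<lambda>s. func s n a \<and> fapply s i \<epsilon> fapply s j) \<epsilon> fapply D n \<and>
        set_of (\<lambda>s. func s n a \<and> fapply s i = fapply s j) \<epsilon> fapply D n) \<and>
      (\<forall>R. R \<epsilon> fapply D n \<longrightarrow> set_of (\<lambda>s. func s n a \<and> \<not> s \<epsilon> R) \<epsilon> fapply D n) \<and>
      (\<forall>R S. R \<epsilon> fapply D n \<and> S \<epsilon> fapply D n \<longrightarrow>
        set_of (\<lambda>s. s \<epsilon> R \<and> s \<epsilon> S) \<epsilon> fapply D n) \<and>
      (\<forall>R. R \<epsilon> fapply D (succ n) \<longrightarrow>
        set_of (\<lambda>s. func s n a \<and> (\<exists>t. t \<epsilon> R \<and> subset_of s t)) \<epsilon> fapply D n))"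

definition def_rel :: "'m \<Rightarrow> 'm \<Rightarrow> 'm \<Rightarrow> bool" where
  "def_rel a n R \<longleftrightarrow> (\<forall>D. def_closed a D \<longrightarrow> R \<epsilon> fapply D n)"

text \<open>
  The parameters are the entries of \<open>s\<close>; the tuple \<open>t\<close> is \<open>s\<close> extended by \<open>x\<close>.
\<close>

definition def_subset :: "'m \<Rightarrow> 'm \<Rightarrow> bool" where
  "def_subset a X \<longleftrightarrow>
    (\<exists>n s R. n \<epsilon> omega \<and> func s n a \<and> def_rel a (succ n) R \<and>
      (\<forall>x. x \<epsilon> X \<longleftrightarrow> x \<epsilon> a \<and> (\<exists>t. t \<epsilon> R \<and> subset_of s t \<and> opair n x \<epsilon> t)))"

definition ordinal :: "'m \<Rightarrow> bool" where
  "ordinal a \<longleftrightarrow> (\<forall>x. x \<epsilon> a \<longrightarrow> subset_of x a) \<and>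
    (\<forall>x y. x \<epsilon> a \<and> y \<epsilon> x \<longrightarrow> subset_of y x)"

definition L_hierarchy :: "'m \<Rightarrow> 'm \<Rightarrow> bool" where
  "L_hierarchy a f \<longleftrightarrow> ordinal a \<and> func_on f a \<and>
    (\<forall>b. b \<epsilon> a \<longrightarrow>
      (\<forall>x. x \<epsilon> fapply f b \<longleftrightarrow> (\<exists>c. c \<epsilon> b \<and> def_subset (fapply f c) x)))"

definition V_eq_L :: bool where
  "V_eq_L \<longleftrightarrow> (\<forall>x. \<exists>a f b. L_hierarchy a f \<and> b \<epsilon> a \<and> x \<epsilon> fapply f b)"

subsection \<open>Cardinals\<close>

definition inj_func :: "'m \<Rightarrow> 'm \<Rightarrow> 'm \<Rightarrow> bool" where
  "inj_func f a b \<longleftrightarrow> func f a b \<and>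
    (\<forall>x y. x \<epsilon> a \<and> y \<epsilon> a \<and> fapply f x = fapply f y \<longrightarrow> x = y)"

definition bij_func :: "'m \<Rightarrow> 'm \<Rightarrow> 'm \<Rightarrow> bool" where
  "bij_func f a b \<longleftrightarrow> inj_func f a b \<and> (\<forall>y. y \<epsilon> b \<longrightarrow> (\<exists>x. x \<epsilon> a \<and> fapply f x = y))"

definition infinite_cardinal :: "'m \<Rightarrow> bool" where
  "infinite_cardinal \<kappa> \<longleftrightarrow> ordinal \<kappa> \<and> subset_of omega \<kappa> \<and>
    (\<forall>a. a \<epsilon> \<kappa> \<longrightarrow> \<not> (\<exists>f. bij_func f a \<kappa>))"

definition cardinal_le :: "'m \<Rightarrow> 'm \<Rightarrow> bool" where
  "cardinal_le a b \<longleftrightarrow> (\<exists>f. inj_func f a b)"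

subsection \<open>Function symbols and elementary formulas\<close>

text \<open>
  In the defining formula (with parameters \<open>e\<close>), variable \<open>0\<close> stands for the value and
  variables \<open>1\<close> to \<open>k\<close> for the arguments.
\<close>

definition definable_fun :: "nat \<Rightarrow> ('m list \<Rightarrow> 'm) \<Rightarrow> bool" where
  "definable_fun k f \<longleftrightarrow>
    (\<exists>\<phi> e. \<forall>xs y. length xs = k \<longrightarrow>
      (f xs = y \<longleftrightarrow> sat (\<lambda>i. if i \<le> k then (y # xs) ! i else e i) \<phi>))"

primrec wf_fterm :: "'m fterm \<Rightarrow> bool" where
  "wf_fterm (Var x) \<longleftrightarrow> True"
| "wf_fterm (Ind a) \<longleftrightarrow> True"
| "wf_fterm (Fun f ts) \<longleftrightarrow> definable_fun (length ts) f \<and> list_all id (map wf_fterm ts)"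

primrec wf_elementary :: "'m elementary \<Rightarrow> bool" where
  "wf_elementary Top \<longleftrightarrow> True"
| "wf_elementary Bot \<longleftrightarrow> True"
| "wf_elementary (EqImp t u F) \<longleftrightarrow> wf_fterm t \<and> wf_fterm u \<and> wf_elementary F"
| "wf_elementary (Univ x F) \<longleftrightarrow> wf_elementary F"
| "wf_elementary (Imp F G) \<longleftrightarrow> wf_elementary F \<and> wf_elementary G"
| "wf_elementary (ForallInt x F) \<longleftrightarrow> wf_elementary F"

definition closed_elementary :: "'m elementary \<Rightarrow> bool" where
  "closed_elementary F \<longleftrightarrow> wf_elementary F \<and> free_vars F = {}"

end


section \<open>Realizability algebras\<close>

text \<open>
  All components are individuals of the ground model; the operations are functions in the sense
  of the model.
\<close>

record 'm algebra =
  Terms :: 'm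
  Stacks :: 'm
  Processes :: 'm
  app_fun :: 'm
  push_fun :: 'm
  process_fun :: 'm
  cont_fun :: 'm
  iB :: 'm
  iC :: 'm
  iI :: 'm
  iK :: 'm
  iW :: 'm
  icc :: 'm
  pole :: 'm
  QP :: 'm

context set_structure
begin

definition app :: "'m algebra \<Rightarrow> 'm \<Rightarrow> 'm \<Rightarrow> 'm" where
  "app A \<xi> \<eta> = fapply (app_fun A) (opair \<xi> \<eta>)"

definition push :: "'m algebra \<Rightarrow> 'm \<Rightarrow> 'm \<Rightarrow> 'm" where
  "push A \<xi> \<pi> = fapply (push_fun A) (opair \<xi> \<pi>)"

definition process :: "'m algebra \<Rightarrow> 'm \<Rightarrow> 'm \<Rightarrow> 'm" where
  "process A \<xi> \<pi> = fapply (process_fun A) (opair \<xi> \<pi>)"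

definition cont :: "'m algebra \<Rightarrow> 'm \<Rightarrow> 'm" where
  "cont A \<pi> = fapply (cont_fun A) \<pi>"

inductive exec1 :: "'m algebra \<Rightarrow> 'm \<Rightarrow> 'm \<Rightarrow> bool" for A where
  exec_app: "\<xi> \<epsilon> Terms A \<Longrightarrow> \<eta> \<epsilon> Terms A \<Longrightarrow> \<pi> \<epsilon> Stacks A \<Longrightarrow>
    exec1 A (process A (app A \<xi> \<eta>) \<pi>) (process A \<xi> (push A \<eta> \<pi>))"
| exec_I: "\<xi> \<epsilon> Terms A \<Longrightarrow> \<pi> \<epsilon> Stacks A \<Longrightarrow>
    exec1 A (process A (iI A) (push A \<xi> \<pi>)) (process A \<xi> \<pi>)"
| exec_K: "\<xi> \<epsilon> Terms A \<Longrightarrow> \<eta> \<epsilon> Terms A \<Longrightarrow> \<pi> \<epsilon> Stacks A \<Longrightarrow>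
    exec1 A (process A (iK A) (push A \<xi> (push A \<eta> \<pi>))) (process A \<xi> \<pi>)"
| exec_W: "\<xi> \<epsilon> Terms A \<Longrightarrow> \<eta> \<epsilon> Terms A \<Longrightarrow> \<pi> \<epsilon> Stacks A \<Longrightarrow>
    exec1 A (process A (iW A) (push A \<xi> (push A \<eta> \<pi>)))
      (process A \<xi> (push A \<eta> (push A \<eta> \<pi>)))"
| exec_C: "\<xi> \<epsilon> Terms A \<Longrightarrow> \<eta> \<epsilon> Terms A \<Longrightarrow> \<zeta> \<epsilon> Terms A \<Longrightarrow> \<pi> \<epsilon> Stacks A \<Longrightarrow>
    exec1 A (process A (iC A) (push A \<xi> (push A \<eta> (push A \<zeta> \<pi>))))
      (process A \<xi> (push A \<zeta> (push A \<eta> \<pi>)))"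
| exec_B: "\<xi> \<epsilon> Terms A \<Longrightarrow> \<eta> \<epsilon> Terms A \<Longrightarrow> \<zeta> \<epsilon> Terms A \<Longrightarrow> \<pi> \<epsilon> Stacks A \<Longrightarrow>
    exec1 A (process A (iB A) (push A \<xi> (push A \<eta> (push A \<zeta> \<pi>))))
      (process A \<xi> (push A (app A \<eta> \<zeta>) \<pi>))"
| exec_cc: "\<xi> \<epsilon> Terms A \<Longrightarrow> \<pi> \<epsilon> Stacks A \<Longrightarrow>
    exec1 A (process A (icc A) (push A \<xi> \<pi>)) (process A \<xi> (push A (cont A \<pi>) \<pi>))"
| exec_cont: "\<xi> \<epsilon> Terms A \<Longrightarrow> \<pi> \<epsilon> Stacks A \<Longrightarrow> \<rho> \<epsilon> Stacks A \<Longrightarrow>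
    exec1 A (process A (cont A \<pi>) (push A \<xi> \<rho>)) (process A \<xi> \<pi>)"

text \<open>
  This is the external reflexive transitive closure. The closure formed inside the model may be
  larger, but a pole that belongs to the model and is closed under single steps is closed under
  both.
\<close>

definition exec :: "'m algebra \<Rightarrow> 'm \<Rightarrow> 'm \<Rightarrow> bool" where
  "exec A = (exec1 A)\<^sup>*\<^sup>*"

definition realizability_algebra :: "'m algebra \<Rightarrow> bool" where
  "realizability_algebra A \<longleftrightarrow>
    func (app_fun A) (cprod (Terms A) (Terms A)) (Terms A) \<and>
    func (push_fun A) (cprod (Terms A) (Stacks A)) (Stacks A) \<and>
    func (process_fun A) (cprod (Terms A) (Stacks A)) (Processes A) \<and>
    func (cont_fun A) (Stacks A) (Terms A) \<and>
    subset_of (pole A) (Processes A) \<and>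
    (\<forall>s s'. exec A s s' \<and> s' \<epsilon> pole A \<longrightarrow> s \<epsilon> pole A) \<and>
    subset_of (QP A) (Terms A) \<and>
    iB A \<epsilon> QP A \<and> iC A \<epsilon> QP A \<and> iI A \<epsilon> QP A \<and> iK A \<epsilon> QP A \<and> iW A \<epsilon> QP A \<and> icc A \<epsilon> QP A \<and>
    (\<forall>\<theta> \<theta>'. \<theta> \<epsilon> QP A \<and> \<theta>' \<epsilon> QP A \<longrightarrow> app A \<theta> \<theta>' \<epsilon> QP A)"

definition coherent :: "'m algebra \<Rightarrow> bool" where
  "coherent A \<longleftrightarrow> (\<forall>\<theta>. \<theta> \<epsilon> QP A \<longrightarrow> (\<exists>\<pi>. \<pi> \<epsilon> Stacks A \<and> \<not> process A \<theta> \<pi> \<epsilon> pole A))"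

definition sigma :: "'m algebra \<Rightarrow> 'm" where
  "sigma A = app A (app A (iB A) (iW A)) (app A (iB A) (iB A))"

definition numerals :: "'m algebra \<Rightarrow> 'm" where
  "numerals A = (THE f. func f omega (Terms A) \<and> fapply f empty = app A (iK A) (iI A) \<and>
    (\<forall>n. n \<epsilon> omega \<longrightarrow> fapply f (succ n) = app A (sigma A) (fapply f n)))"

definition numeral_of :: "'m algebra \<Rightarrow> 'm \<Rightarrow> 'm" where
  "numeral_of A n = fapply (numerals A) n"

text \<open>Only closed combinatory terms are evaluated.\<close>

primrec cterm_val :: "'m algebra \<Rightarrow> cterm \<Rightarrow> 'm" where
  "cterm_val A (CVar x) = undefined"
| "cterm_val A CB = iB A"
| "cterm_val A CC = iC A"
| "cterm_val A CI = iI A"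
| "cterm_val A CK = iK A"
| "cterm_val A CW = iW A"
| "cterm_val A Ccc = icc A"
| "cterm_val A (t \<cdot> u) = app A (cterm_val A t) (cterm_val A u)"

subsection \<open>Realizability\<close>

definition orthogonal :: "'m algebra \<Rightarrow> 'm set \<Rightarrow> 'm set" where
  "orthogonal A S = {\<xi>. \<xi> \<epsilon> Terms A \<and> (\<forall>\<pi>\<in>S. process A \<xi> \<pi> \<epsilon> pole A)}"

text \<open>
  An assignment \<open>e\<close> replaces the substitution of individuals for free variables.
\<close>

primrec falsity :: "'m algebra \<Rightarrow> (nat \<Rightarrow> 'm) \<Rightarrow> 'm elementary \<Rightarrow> 'm set" where
  "falsity A e Top = {}"
| "falsity A e Bot = {\<pi>. \<pi> \<epsilon> Stacks A}"
| "falsity A e (EqImp t u F) = (if fterm_val e t = fterm_val e u then falsity A e F else {})"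
| "falsity A e (Univ x F) = (\<Union>a. falsity A (e(x := a)) F)"
| "falsity A e (Imp F G) =
    {push A \<xi> \<pi> | \<xi> \<pi>. \<xi> \<in> orthogonal A (falsity A e F) \<and> \<pi> \<in> falsity A e G}"
| "falsity A e (ForallInt x F) =
    {push A (numeral_of A n) \<pi> | n \<pi>. n \<epsilon> omega \<and> \<pi> \<in> falsity A (e(x := n)) F}"

definition realizes :: "'m algebra \<Rightarrow> (nat \<Rightarrow> 'm) \<Rightarrow> 'm \<Rightarrow> 'm elementary \<Rightarrow> bool" where
  "realizes A e \<xi> F \<longleftrightarrow> \<xi> \<in> orthogonal A (falsity A e F)"

text \<open>The truth of a closed formula does not depend on the assignment.\<close>

definition realized :: "'m algebra \<Rightarrow> 'm elementary \<Rightarrow> bool" where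
  "realized A F \<longleftrightarrow> (\<exists>\<theta>. \<theta> \<epsilon> QP A \<and> (\<forall>e. realizes A e \<theta> F))"

subsection \<open>The extended algebra\<close>

definition fin_seqs :: "'m \<Rightarrow> 'm" where
  "fin_seqs \<kappa> = set_of (\<lambda>p. \<exists>n. n \<epsilon> omega \<and> func p n \<kappa>)"

text \<open>
  The additional condition \<open>z\<close> may be any individual that is not in \<open>fin_seqs \<kappa>\<close>.
\<close>

definition conditions :: "'m \<Rightarrow> 'm \<Rightarrow> 'm" where
  "conditions \<kappa> z = union (fin_seqs \<kappa>) (upair z z)"

definition cmult :: "'m \<Rightarrow> 'm \<Rightarrow> 'm \<Rightarrow> 'm" where
  "cmult z p q =
    (if p \<noteq> z \<and> q \<noteq> z \<and> subset_of p q then q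
     else if p \<noteq> z \<and> q \<noteq> z \<and> subset_of q p then p
     else z)"

text \<open>
  The pole \<open>b\<close> is a parameter because its specification, \<open>extended_pole\<close>, describes membership of
  a pair of \<open>\<xi> \<star> \<pi>\<close> and \<open>p\<close> in terms of \<open>\<xi>\<close> and \<open>\<pi>\<close>. This determines \<open>b\<close> on such pairs;
  if \<open>\<star>\<close> is injective, then such a \<open>b\<close> exists.
\<close>

definition extended_pole :: "'m algebra \<Rightarrow> 'm \<Rightarrow> 'm \<Rightarrow> 'm \<Rightarrow> bool" where
  "extended_pole A \<kappa> z b \<longleftrightarrow>
    subset_of b (cprod (Processes A) (conditions \<kappa> z)) \<and>
    (\<forall>\<xi> \<pi> p. \<xi> \<epsilon> Terms A \<and> \<pi> \<epsilon> Stacks A \<and> p \<epsilon> conditions \<kappa> z \<longrightarrow>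
      (opair (process A \<xi> \<pi>) p \<epsilon> b \<longleftrightarrow>
        (\<forall>n. n \<epsilon> omega \<and> p \<noteq> z \<and> subset_of (dom p) n \<longrightarrow>
          process A \<xi> (push A (numeral_of A n) \<pi>) \<epsilon> pole A)))"

definition extended_algebra :: "'m algebra \<Rightarrow> 'm \<Rightarrow> 'm \<Rightarrow> 'm \<Rightarrow> 'm algebra" where
  "extended_algebra A \<kappa> z b = \<lparr>
    Terms = cprod (Terms A) (conditions \<kappa> z),
    Stacks = cprod (Stacks A) (conditions \<kappa> z),
    Processes = cprod (Processes A) (conditions \<kappa> z),
    app_fun = set_of (\<lambda>w. \<exists>\<xi> p \<eta> q.
      \<xi> \<epsilon> Terms A \<and> p \<epsilon> conditions \<kappa> z \<and> \<eta> \<epsilon> Terms A \<and> q \<epsilon> conditions \<kappa> z \<and>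
      w = opair (opair (opair \<xi> p) (opair \<eta> q)) (opair (app A (app A (iC A) \<xi>) \<eta>) (cmult z p q))),
    push_fun = set_of (\<lambda>w. \<exists>\<xi> p \<pi> q.
      \<xi> \<epsilon> Terms A \<and> p \<epsilon> conditions \<kappa> z \<and> \<pi> \<epsilon> Stacks A \<and> q \<epsilon> conditions \<kappa> z \<and>
      w = opair (opair (opair \<xi> p) (opair \<pi> q)) (opair (push A \<xi> \<pi>) (cmult z p q))),
    process_fun = set_of (\<lambda>w. \<exists>\<xi> p \<pi> q.
      \<xi> \<epsilon> Terms A \<and> p \<epsilon> conditions \<kappa> z \<and> \<pi> \<epsilon> Stacks A \<and> q \<epsilon> conditions \<kappa> z \<and>
      w = opair (opair (opair \<xi> p) (opair \<pi> q)) (opair (process A \<xi> \<pi>) (cmult z p q))),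
    cont_fun = set_of (\<lambda>w. \<exists>\<pi> p.
      \<pi> \<epsilon> Stacks A \<and> p \<epsilon> conditions \<kappa> z \<and>
      w = opair (opair \<pi> p) (opair (app A (iC A) (app A (iB A) (cont A \<pi>))) p)),
    iB = opair (cterm_val A B_star) empty,
    iC = opair (cterm_val A C_star) empty,
    iI = opair (cterm_val A I_star) empty,
    iK = opair (cterm_val A K_star) empty,
    iW = opair (cterm_val A W_star) empty,
    icc = opair (cterm_val A cc_star) empty,
    pole = b,
    QP = set_of (\<lambda>w. \<exists>\<theta>. \<theta> \<epsilon> QP A \<and> w = opair \<theta> empty) \<rparr>"

end

end

theory Submission
  imports Defs
begin

text \<open>
  By induction on the elementary formula \<open>F\<close> there are proof-like terms \<open>\<theta>\<close> and \<open>\<theta>'\<close> such that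
  \<open>\<tau> \<tturnstile> F\<close> over \<open>A\<close> implies \<open>(\<theta> \<tau>, p) \<tturnstile> F\<close> over the extended algebra for every condition \<open>p\<close>, and
  \<open>(\<tau>, p) \<tturnstile> F\<close> over the extended algebra implies \<open>\<theta>' m \<tau> \<tturnstile> F\<close> over \<open>A\<close> for every integer \<open>m\<close>
  above the length of \<open>p \<noteq> z\<close>: the integer on top of a stack of the extended algebra bounds all
  conditions that occur in that stack, and the induction never needs a condition other than the
  given one and \<open>\<emptyset>\<close>. For \<open>\<forall>n\<^sup>i\<^sup>n\<^sup>t\<close> the integers of the two algebras are different terms of \<open>A\<close>;
  they are converted into each other by storage operators.
\<close>

section \<open>Definable predicates\<close>

text \<open>Both directions must go through one induction, since an implication uses the transfer of
  its premise in the opposite direction. They are not symmetric: a stack of the extended algebra is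
  tested with an integer on top, which \<open>\<theta>\<close> can read there, whereas a stack of
  \<open>A\<close> brings none, so \<open>\<theta>'\<close> takes one as an argument. Extended
  application is \<open>C \<xi> \<eta>\<close> in \<open>A\<close>: it puts \<open>\<eta>\<close>
  below that integer, so that the head always finds the integer first. The induction on the formula
  is external, but the integers are individuals of a possibly nonstandard model, so every fact about
  all integers needs an induction inside the model. Since the separation scheme speaks only of coded
  formulas, predicates written in HOL have to be shown definable first; this calls for a calculus of
  definable predicates and functions. The pole is closed only under anti-execution. Knowledge about
  a process therefore passes to the processes that lead to it, never forwards, and this dictates the
  shape of the combinators.\<close>

context set_structure
begin

text \<open>\<open>h\<close> sends each index of the formula either to a variable read from
  \<open>e\<close> or to a fixed individual, so parameters are allowed. Variables are handled in De
  Bruijn style: the one to be bound is \<open>e 0\<close>, and the outer ones move up by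
  one.\<close>

definition definable :: "((nat \<Rightarrow> 'm) \<Rightarrow> bool) \<Rightarrow> bool" where
  "definable P \<longleftrightarrow> (\<exists>\<phi> h. \<forall>e. P e \<longleftrightarrow> sat (\<lambda>i. case_sum e id (h i)) \<phi>)"

definition dfun :: "((nat \<Rightarrow> 'm) \<Rightarrow> 'm) \<Rightarrow> bool" where
  "dfun t \<longleftrightarrow> definable (\<lambda>e. e 0 = t (\<lambda>n. e (Suc n)))"

lemma definableI: "(\<And>e. P e \<longleftrightarrow> sat (\<lambda>i. case_sum e id (h i)) \<phi>) \<Longrightarrow> definable P"
  unfolding definable_def by (intro exI allI)

lemma definableE:
  assumes "definable P"
  obtains \<phi> h where "\<And>e. P e \<longleftrightarrow> sat (\<lambda>i. case_sum e id (h i)) \<phi>"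
  using assms unfolding definable_def by (elim exE) (rule that, erule spec)

text \<open>Infinitely many free indices remain, so that bound variables can be renamed apart.\<close>

lemma sat_rename:
  assumes "infinite (- range \<rho>)"
  shows "\<exists>\<psi>. \<forall>e. sat e \<psi> \<longleftrightarrow> sat (\<lambda>i. e (\<rho> i)) \<phi>"
  using assms
proof (induction \<phi> arbitrary: \<rho>)
  case (Mem i j)
  show ?case by (rule exI[of _ "Mem (\<rho> i) (\<rho> j)"]) simp
next
  case (Eq i j)
  show ?case by (rule exI[of _ "Eq (\<rho> i) (\<rho> j)"]) simp
next
  case (Neg \<phi>)
  then obtain \<psi> where "\<forall>e. sat e \<psi> \<longleftrightarrow> sat (\<lambda>i. e (\<rho> i)) \<phi>" by blast
  then show ?case by (intro exI[of _ "Neg \<psi>"]) simp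
next
  case (And \<phi>1 \<phi>2)
  then obtain \<psi>1 \<psi>2 where "\<forall>e. sat e \<psi>1 \<longleftrightarrow> sat (\<lambda>i. e (\<rho> i)) \<phi>1"
    "\<forall>e. sat e \<psi>2 \<longleftrightarrow> sat (\<lambda>i. e (\<rho> i)) \<phi>2" by meson
  then show ?case by (intro exI[of _ "And \<psi>1 \<psi>2"]) simp
next
  case (Forall i \<phi>)
  obtain j where j: "j \<notin> range \<rho>"
    using Forall.prems by (metis ComplD ex_in_conv finite.emptyI)
  have "range (\<rho>(i := j)) \<subseteq> insert j (range \<rho>)" by auto
  then have "- range \<rho> - {j} \<subseteq> - range (\<rho>(i := j))" by blast
  moreover have "infinite (- range \<rho> - {j})" using Forall.prems by simp
  ultimately have "infinite (- range (\<rho>(i := j)))" using infinite_super by blast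
  then obtain \<psi> where \<psi>: "\<And>e. sat e \<psi> \<longleftrightarrow> sat (\<lambda>k. e ((\<rho>(i := j)) k)) \<phi>"
    using Forall.IH by blast
  have "(\<lambda>k. (e(j := a)) ((\<rho>(i := j)) k)) = (\<lambda>k. e (\<rho> k))(i := a)" for e :: "nat \<Rightarrow> 'm" and a
    using j by fastforce
  then show ?case by (intro exI[of _ "Forall j \<psi>"]) (simp add: \<psi>)
qed

lemma definable_rename:
  assumes "definable P"
  shows "definable (\<lambda>e. P (\<lambda>i. e (\<rho> i)))"
proof -
  obtain \<phi> h where "\<And>e. P e \<longleftrightarrow> sat (\<lambda>i. case_sum e id (h i)) \<phi>"
    using assms by (auto elim: definableE)
  moreover have "case_sum (\<lambda>i. e (\<rho> i)) id x = case_sum e id (map_sum \<rho> id x)"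
    for e :: "nat \<Rightarrow> 'm" and x by (cases x) simp_all
  ultimately have "P (\<lambda>i. e (\<rho> i)) \<longleftrightarrow> sat (\<lambda>i. case_sum e id (map_sum \<rho> id (h i))) \<phi>" for e
    by simp
  then show ?thesis by (rule definableI)
qed

lemma definable_not: "definable P \<Longrightarrow> definable (\<lambda>e. \<not> P e)"
  unfolding definable_def by (metis sat.simps(3))

lemma definable_conj:
  assumes "definable P" "definable Q"
  shows "definable (\<lambda>e. P e \<and> Q e)"
proof -
  obtain \<phi> h where P: "\<And>e. P e \<longleftrightarrow> sat (\<lambda>i. case_sum e id (h i)) \<phi>"
    using assms by (auto elim: definableE)
  obtain \<psi> k where Q: "\<And>e. Q e \<longleftrightarrow> sat (\<lambda>i. case_sum e id (k i)) \<psi>"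
    using assms by (auto elim: definableE)
  \<comment> \<open>Modulo 3, the indices of \<open>\<phi>\<close> get residue 0 and those of
    \<open>\<psi>\<close> residue 1, so they do not clash; residue 2 stays free, as
    \<open>sat_rename\<close> demands.\<close>
  have "inj (\<lambda>i::nat. 3 * i + 2)" by (simp add: inj_def)
  then have inf: "infinite (range (\<lambda>i::nat. 3 * i + 2))" using finite_imageD infinite_UNIV_nat by blast
  have "range (\<lambda>i::nat. 3 * i + 2) \<subseteq> - range (\<lambda>i. 3 * i)" by auto presburger
  with inf have "infinite (- range (\<lambda>i::nat. 3 * i))" using infinite_super by blast
  then obtain \<phi>' where \<phi>': "\<And>e. sat e \<phi>' \<longleftrightarrow> sat (\<lambda>i. e (3 * i)) \<phi>"
    using sat_rename by blast
  have "range (\<lambda>i::nat. 3 * i + 2) \<subseteq> - range (\<lambda>i. 3 * i + 1)" by auto presburger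
  with inf have "infinite (- range (\<lambda>i::nat. 3 * i + 1))" using infinite_super by blast
  then obtain \<psi>' where \<psi>': "\<And>e. sat e \<psi>' \<longleftrightarrow> sat (\<lambda>i. e (3 * i + 1)) \<psi>"
    using sat_rename by blast
  let ?h = "\<lambda>i. if i mod 3 = 0 then h (i div 3) else k (i div 3)"
  have "P e \<and> Q e \<longleftrightarrow> sat (\<lambda>i. case_sum e id (?h i)) (And \<phi>' \<psi>')" for e
    by (simp add: P Q \<phi>' \<psi>' div_Suc)
  then show ?thesis by (rule definableI)
qed

text \<open>Several indices may stand for the variable to be bound. They are merged into index 0,
  where one quantifier, or the distinguished variable of the separation scheme, catches them
  all.\<close>

lemma sat_bind:
  assumes "\<And>e. Q (\<lambda>n. e (Suc n)) (e 0) \<longleftrightarrow> sat (\<lambda>i. case_sum e id (h i)) \<phi>"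
  shows "\<exists>\<psi> k. \<forall>e a. Q e a \<longleftrightarrow> sat ((\<lambda>i. case_sum e id (k i))(0 := a)) \<psi>"
proof -
  \<comment> \<open>The remaining indices become even numbers from 2 on; the odd ones stay free for
    renaming.\<close>
  let ?\<rho> = "\<lambda>i. if h i = Inl 0 then 0 else 2 * i + 2"
  have "inj (\<lambda>i::nat. 2 * i + 1)" by (simp add: inj_def)
  then have "infinite (range (\<lambda>i::nat. 2 * i + 1))" using finite_imageD infinite_UNIV_nat by blast
  moreover have "2 * i + 1 \<noteq> 2 * j + (2::nat)" for i j by presburger
  then have "range (\<lambda>i. 2 * i + 1) \<subseteq> - range ?\<rho>" by (auto split: if_splits)
  ultimately have "infinite (- range ?\<rho>)" using infinite_super by blast
  then obtain \<psi> where \<psi>: "\<And>e. sat e \<psi> \<longleftrightarrow> sat (\<lambda>i. e (?\<rho> i)) \<phi>"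
    using sat_rename by blast
  \<comment> \<open>\<open>j - 1\<close> undoes the De Bruijn shift; the value at index 0 is
    overwritten by \<open>a\<close>.\<close>
  let ?k = "\<lambda>i. map_sum (\<lambda>j. j - 1) id (h ((i - 2) div 2))"
  have "Q e a \<longleftrightarrow> sat ((\<lambda>i. case_sum e id (?k i))(0 := a)) \<psi>" for e a
  proof -
    have "Q e a \<longleftrightarrow> sat (\<lambda>i. case_sum (case_nat a e) id (h i)) \<phi>"
      using assms[of "case_nat a e"] by simp
    moreover have "case_sum (case_nat a e) id (h i) =
        ((\<lambda>i. case_sum e id (?k i))(0 := a)) (?\<rho> i)" for i
      by (cases "h i") (auto split: nat.split)
    ultimately show ?thesis unfolding \<psi> by (simp only:)
  qed
  then show ?thesis by (intro exI allI)
qed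

lemma definable_all:
  assumes "definable (\<lambda>e. Q (\<lambda>n. e (Suc n)) (e 0))"
  shows "definable (\<lambda>e. \<forall>a. Q e a)"
proof -
  obtain \<phi> h where "\<And>e. Q (\<lambda>n. e (Suc n)) (e 0) \<longleftrightarrow> sat (\<lambda>i. case_sum e id (h i)) \<phi>"
    using assms by (auto elim: definableE)
  from sat_bind[of Q, OF this] obtain \<psi> k
    where "\<And>e a. Q e a \<longleftrightarrow> sat ((\<lambda>i. case_sum e id (k i))(0 := a)) \<psi>" by blast
  then have "(\<forall>a. Q e a) \<longleftrightarrow> sat (\<lambda>i. case_sum e id (k i)) (Forall 0 \<psi>)" for e
    by simp
  then show ?thesis by (rule definableI)
qed

lemma definable_disj:
  assumes "definable P" "definable Q"
  shows "definable (\<lambda>e. P e \<or> Q e)"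
proof -
  have "definable (\<lambda>e. \<not> (\<not> P e \<and> \<not> Q e))"
    by (intro definable_not definable_conj assms)
  then show ?thesis by simp
qed

lemma definable_imp:
  assumes "definable P" "definable Q"
  shows "definable (\<lambda>e. P e \<longrightarrow> Q e)"
  unfolding imp_conv_disj by (intro definable_disj definable_not assms)

lemma definable_iff:
  assumes "definable P" "definable Q"
  shows "definable (\<lambda>e. P e \<longleftrightarrow> Q e)"
  unfolding iff_conv_conj_imp by (intro definable_conj definable_imp assms)

lemma definable_ex:
  assumes "definable (\<lambda>e. Q (\<lambda>n. e (Suc n)) (e 0))"
  shows "definable (\<lambda>e. \<exists>a. Q e a)"
proof -
  have "definable (\<lambda>e. \<not> (\<forall>a. \<not> Q e a))"
    by (intro definable_not definable_all assms)
  then show ?thesis by simp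
qed

text \<open>\<open>set_formula\<close> has no function symbols, so the value of \<open>t\<close> is
  named by a quantified variable.\<close>

lemma definable_subst:
  assumes "dfun t" "definable (\<lambda>e. Q (\<lambda>n. e (Suc n)) (e 0))"
  shows "definable (\<lambda>e. Q e (t e))"
proof -
  have "definable (\<lambda>e. \<exists>y. y = t e \<and> Q e y)"
    by (rule definable_ex, rule definable_conj) (use assms in \<open>simp_all add: dfun_def\<close>)
  then show ?thesis by simp
qed

lemma dfun_shift:
  assumes "dfun t"
  shows "dfun (\<lambda>e. t (\<lambda>n. e (Suc n)))"
  using definable_rename[OF assms[unfolded dfun_def],
    of "\<lambda>n. case n of 0 \<Rightarrow> 0 | Suc n \<Rightarrow> Suc (Suc n)"]
  by (simp add: dfun_def)

lemma definable_binary: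
  assumes "definable (\<lambda>e. R (e 0) (e (Suc 0)))" "dfun t" "dfun u"
  shows "definable (\<lambda>e. R (t e) (u e))"
proof (rule definable_subst[OF assms(2), of "\<lambda>e y. R y (u e)"],
    rule definable_subst[OF dfun_shift[OF assms(3)], of "\<lambda>e y. R (e 0) y"])
  show "definable (\<lambda>e. R (e (Suc 0)) (e 0))"
    using definable_rename[OF assms(1), of "\<lambda>n. if n = 0 then Suc 0 else 0"] by simp
qed

lemma dfun_var: "dfun (\<lambda>e. e i)"
  unfolding dfun_def
  by (rule definableI[of _ "\<lambda>n. if n = 0 then Inl 0 else Inl (Suc i)" "Eq 0 1"]) simp

lemma dfun_const: "dfun (\<lambda>e. c)"
  unfolding dfun_def
  by (rule definableI[of _ "\<lambda>n. if n = 0 then Inl 0 else Inr c" "Eq 0 1"]) simp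

lemma definable_mem: "dfun t \<Longrightarrow> dfun u \<Longrightarrow> definable (\<lambda>e. t e \<epsilon> u e)"
  by (rule definable_binary[of "\<lambda>a b. a \<epsilon> b"])
    (rule definableI[of _ Inl "Mem 0 1"], simp_all)

lemma definable_eq: "dfun t \<Longrightarrow> dfun u \<Longrightarrow> definable (\<lambda>e. t e = u e)"
  by (rule definable_binary[of "\<lambda>a b. a = b"])
    (rule definableI[of _ Inl "Eq 0 1"], simp_all)

lemma dfun_unary:
  assumes "dfun (\<lambda>e. g (e 0))" "dfun t"
  shows "dfun (\<lambda>e. g (t e))"
  unfolding dfun_def
  by (rule definable_binary[of "\<lambda>a b. a = g b", OF _ dfun_var dfun_shift[OF assms(2)]])
    (use assms(1) in \<open>simp add: dfun_def\<close>)

lemma dfun_binary: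
  assumes "dfun (\<lambda>e. g (e 0) (e (Suc 0)))" "dfun t" "dfun u"
  shows "dfun (\<lambda>e. g (t e) (u e))"
  unfolding dfun_def
proof (rule definable_subst[OF dfun_shift[OF assms(2)], of "\<lambda>e y. e 0 = g y (u (\<lambda>n. e (Suc n)))"],
    rule definable_binary[of "\<lambda>a b. a = b", OF _ dfun_var])
  show "definable (\<lambda>e. e 0 = e (Suc 0))" by (intro definable_eq dfun_var)
  show "dfun (\<lambda>e. g (e 0) (u (\<lambda>n. e (Suc (Suc n)))))"
    unfolding dfun_def
  proof (rule definable_subst[OF dfun_shift[OF dfun_shift[OF dfun_shift[OF assms(3)]]],
        of "\<lambda>e y. e 0 = g (e (Suc 0)) y"])
    show "definable (\<lambda>e. e (Suc 0) = g (e (Suc (Suc 0))) (e 0))"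
      using definable_rename[OF assms(1)[unfolded dfun_def],
          of "\<lambda>n. if n = 0 then Suc 0 else if n = Suc 0 then Suc (Suc 0) else 0"] by simp
  qed
qed

lemma definable_ex1:
  assumes "definable (\<lambda>e. Q (\<lambda>n. e (Suc n)) (e 0))"
  shows "definable (\<lambda>e. \<exists>!a. Q e a)"
proof -
  have "definable (\<lambda>e. \<exists>a. \<forall>b. Q e b \<longleftrightarrow> b = a)"
    by (rule definable_ex, rule definable_all, rule definable_iff)
      (use definable_rename[OF assms, of "\<lambda>n. case n of 0 \<Rightarrow> 0 | Suc n \<Rightarrow> Suc (Suc n)"] in simp,
        intro definable_eq dfun_var)
  moreover have "(\<exists>a. \<forall>b. Q e b \<longleftrightarrow> b = a) \<longleftrightarrow> (\<exists>!a. Q e a)" for e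
    by (rule iffI; metis)
  ultimately show ?thesis by simp
qed

lemma dfun_If:
  assumes "definable P" "dfun t" "dfun u"
  shows "dfun (\<lambda>e. if P e then t e else u e)"
proof -
  have "definable (\<lambda>e. (P (\<lambda>n. e (Suc n)) \<and> e 0 = t (\<lambda>n. e (Suc n))) \<or>
      (\<not> P (\<lambda>n. e (Suc n)) \<and> e 0 = u (\<lambda>n. e (Suc n))))"
    using assms(2,3) unfolding dfun_def
    by (intro definable_disj definable_conj definable_not definable_rename[OF assms(1)])
  then show ?thesis unfolding dfun_def by (rule back_subst[of definable]) (auto simp: fun_eq_iff)
qed

text \<open>Applied by \<open>intro\<close>, these rules follow the syntax of a predicate, so that
  no coded formula has to be written down.\<close>

lemmas definable_intros = definable_not definable_conj definable_disj definable_imp definable_iff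
  definable_all definable_ex definable_ex1 definable_mem definable_eq dfun_var dfun_const dfun_If

lemma definable_subset_of:
  "dfun t \<Longrightarrow> dfun u \<Longrightarrow> definable (\<lambda>e. subset_of (t e) (u e))"
  by (rule definable_binary[of subset_of]) (unfold subset_of_def, intro definable_intros)

end

section \<open>Set theory in the ground model\<close>

locale zf_structure = set_structure mem for mem :: "'m \<Rightarrow> 'm \<Rightarrow> bool" (infix "\<epsilon>" 50) +
  assumes ZF: ZF
begin

lemma extensionality:
  assumes "\<And>x. x \<epsilon> a \<longleftrightarrow> x \<epsilon> b"
  shows "a = b"
proof -
  have "\<forall>a b. (\<forall>x. x \<epsilon> a \<longleftrightarrow> x \<epsilon> b) \<longrightarrow> a = b"
    using ZF unfolding ZF_def by (elim conjE)
  then show ?thesis using assms by simp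
qed

lemma regularity: "x \<epsilon> a \<Longrightarrow> \<exists>x. x \<epsilon> a \<and> (\<forall>y. y \<epsilon> x \<longrightarrow> \<not> y \<epsilon> a)"
  using ZF[unfolded ZF_def, THEN conjunct2, THEN conjunct1] by blast

lemma pairing: "\<exists>c. \<forall>x. x \<epsilon> c \<longleftrightarrow> x = a \<or> x = b"
  using ZF unfolding ZF_def by (elim conjE) (erule spec2)

lemma union_axiom: "\<exists>c. \<forall>x. x \<epsilon> c \<longleftrightarrow> (\<exists>y. y \<epsilon> a \<and> x \<epsilon> y)"
  using ZF unfolding ZF_def by (elim conjE) (erule spec)

lemma powerset: "\<exists>c. \<forall>x. x \<epsilon> c \<longleftrightarrow> subset_of x a"
  using ZF unfolding ZF_def by (elim conjE) (erule spec)

lemma infinity: "\<exists>a. is_inductive a"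
  using ZF unfolding ZF_def by (elim conjE)

text \<open>\<open>sat_bind\<close> moves the variable of \<open>Q\<close> to index 0, where the
  scheme expects it; parameters disappear into the assignment.\<close>

lemma separation:
  assumes "definable (\<lambda>e. Q (e 0))"
  shows "\<exists>c. \<forall>x. x \<epsilon> c \<longleftrightarrow> x \<epsilon> a \<and> Q x"
proof -
  obtain \<phi> h where "\<And>e :: nat \<Rightarrow> 'm. Q (e 0) \<longleftrightarrow> sat (\<lambda>i. case_sum e id (h i)) \<phi>"
    using assms by (auto elim: definableE)
  from sat_bind[of "\<lambda>e. Q", OF this] obtain \<psi> k
    where "\<And>(e :: nat \<Rightarrow> 'm) x. Q x \<longleftrightarrow> sat ((\<lambda>i. case_sum e id (k i))(0 := x)) \<psi>" by blast
  moreover have "\<forall>\<phi> e a. \<exists>c. \<forall>x. x \<epsilon> c \<longleftrightarrow> x \<epsilon> a \<and> sat (e(0 := x)) \<phi>"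
    using ZF unfolding ZF_def by (elim conjE)
  ultimately show ?thesis by metis
qed

lemma in_set_of:
  assumes "\<exists>c. \<forall>x. x \<epsilon> c \<longleftrightarrow> P x"
  shows "x \<epsilon> set_of P \<longleftrightarrow> P x"
proof -
  obtain c where c: "\<forall>x. x \<epsilon> c \<longleftrightarrow> P x" using assms by blast
  then have "set_of P = c"
    unfolding set_of_def by (rule the_equality) (rule extensionality, simp add: c)
  then show ?thesis using c by simp
qed

text \<open>The \<open>THE\<close> in \<open>set_of\<close> is meaningful only for a class that is a
  set; a bound \<open>a\<close> reduces this to separation.\<close>

lemma in_set_of_bounded:
  assumes "definable (\<lambda>e. Q (e 0))" "\<And>x. Q x \<Longrightarrow> x \<epsilon> a"
  shows "x \<epsilon> set_of Q \<longleftrightarrow> Q x"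
proof (rule in_set_of)
  show "\<exists>c. \<forall>x. x \<epsilon> c \<longleftrightarrow> Q x"
    using separation[OF assms(1), of a] assms(2) by metis
qed

lemma in_empty [simp]: "\<not> x \<epsilon> empty"
proof -
  have "\<exists>c. \<forall>x. x \<epsilon> c \<longleftrightarrow> x \<epsilon> a \<and> False" for a
    by (rule separation) (rule definableI[of _ Inl "And (Mem 0 0) (Neg (Mem 0 0))"], simp)
  then show ?thesis unfolding empty_def by (subst in_set_of) simp_all
qed

lemma in_upair [simp]: "x \<epsilon> upair a b \<longleftrightarrow> x = a \<or> x = b"
  unfolding upair_def by (rule in_set_of[OF pairing])

lemma upair_eq_upair: "upair a b = upair c d \<longleftrightarrow> a = c \<and> b = d \<or> a = d \<and> b = c"
proof
  assume "upair a b = upair c d"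
  then have "x = a \<or> x = b \<longleftrightarrow> x = c \<or> x = d" for x using in_upair by metis
  then show "a = c \<and> b = d \<or> a = d \<and> b = c" by metis
qed (auto intro: extensionality)

lemma opair_inject [simp]: "opair a b = opair c d \<longleftrightarrow> a = c \<and> b = d"
  unfolding opair_def by (auto simp: upair_eq_upair)

lemma in_union [simp]: "x \<epsilon> union a b \<longleftrightarrow> x \<epsilon> a \<or> x \<epsilon> b"
proof -
  have "\<exists>c. \<forall>x. x \<epsilon> c \<longleftrightarrow> x \<epsilon> a \<or> x \<epsilon> b"
    using union_axiom[of "upair a b"] by auto
  then show ?thesis unfolding union_def by (rule in_set_of)
qed

lemma in_succ [simp]: "x \<epsilon> succ a \<longleftrightarrow> x \<epsilon> a \<or> x = a"
  by (simp add: succ_def)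

lemma dfun_upair: "dfun t \<Longrightarrow> dfun u \<Longrightarrow> dfun (\<lambda>e. upair (t e) (u e))"
proof (rule dfun_binary[of upair])
  have "a = upair b c \<longleftrightarrow> (\<forall>x. x \<epsilon> a \<longleftrightarrow> x = b \<or> x = c)" for a b c
    using extensionality[of a "upair b c"] by auto
  then show "dfun (\<lambda>e. upair (e 0) (e (Suc 0)))"
    unfolding dfun_def by (simp, intro definable_intros)
qed

lemma dfun_opair: "dfun t \<Longrightarrow> dfun u \<Longrightarrow> dfun (\<lambda>e. opair (t e) (u e))"
  unfolding opair_def by (intro dfun_upair)

lemma dfun_succ: "dfun t \<Longrightarrow> dfun (\<lambda>e. succ (t e))"
proof (rule dfun_unary[of succ])
  have "a = succ b \<longleftrightarrow> (\<forall>x. x \<epsilon> a \<longleftrightarrow> x \<epsilon> b \<or> x = b)" for a b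
    using extensionality[of a "succ b"] by auto
  then show "dfun (\<lambda>e. succ (e 0))"
    unfolding dfun_def by (simp, intro definable_intros)
qed

lemmas definable_set_intros = definable_intros definable_subset_of dfun_opair dfun_succ

lemma in_cprod: "z \<epsilon> cprod a b \<longleftrightarrow> (\<exists>x y. x \<epsilon> a \<and> y \<epsilon> b \<and> z = opair x y)"
proof -
  \<comment> \<open>A Kuratowski pair consists of subsets of the union of \<open>a\<close> and
    \<open>b\<close>, so it lies in the double power set.\<close>
  obtain c where c: "\<And>x. x \<epsilon> c \<longleftrightarrow> subset_of x (union a b)" using powerset by blast
  obtain d where d: "\<And>x. x \<epsilon> d \<longleftrightarrow> subset_of x c" using powerset by blast
  show ?thesis unfolding cprod_def
  proof (rule in_set_of_bounded)
    show "definable (\<lambda>e. \<exists>x y. x \<epsilon> a \<and> y \<epsilon> b \<and> e 0 = opair x y)"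
      by (intro definable_set_intros)
    show "z \<epsilon> d" if "\<exists>x y. x \<epsilon> a \<and> y \<epsilon> b \<and> z = opair x y" for z
      using that by (auto simp: c d subset_of_def opair_def)
  qed
qed

lemma opair_in_cprod [simp]: "opair x y \<epsilon> cprod a b \<longleftrightarrow> x \<epsilon> a \<and> y \<epsilon> b"
  by (auto simp: in_cprod)

subsection \<open>Functions\<close>

lemma func_value:
  assumes "func f a b" "opair x y \<epsilon> f"
  shows "x \<epsilon> a \<and> y \<epsilon> b \<and> fapply f x = y"
proof -
  have *: "x \<epsilon> a \<and> y \<epsilon> b" using assms unfolding func_def by fastforce
  then have "\<exists>!y. opair x y \<epsilon> f" using assms unfolding func_def by blast
  then show ?thesis using * assms(2) unfolding fapply_def by (simp add: the1_equality)
qed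

lemma func_pair:
  assumes "func f a b" "x \<epsilon> a"
  shows "opair x (fapply f x) \<epsilon> f"
proof -
  have "\<exists>!y. opair x y \<epsilon> f" using assms unfolding func_def by blast
  then show ?thesis unfolding fapply_def by (rule theI')
qed

lemma func_in: "func f a b \<Longrightarrow> x \<epsilon> a \<Longrightarrow> fapply f x \<epsilon> b"
  using func_pair func_value by blast

lemma in_func:
  assumes "func f a b"
  shows "z \<epsilon> f \<longleftrightarrow> (\<exists>x. x \<epsilon> a \<and> z = opair x (fapply f x))"
proof
  assume z: "z \<epsilon> f"
  then obtain x y where "x \<epsilon> a" "z = opair x y" using assms unfolding func_def by blast
  then show "\<exists>x. x \<epsilon> a \<and> z = opair x (fapply f x)" using func_value[OF assms] z by blast
qed (use func_pair[OF assms] in blast)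

lemma func_eqI:
  "func f a b \<Longrightarrow> func g a c \<Longrightarrow> (\<And>x. x \<epsilon> a \<Longrightarrow> fapply f x = fapply g x) \<Longrightarrow> f = g"
  by (rule extensionality) (auto simp: in_func)

lemma dom_func:
  assumes "func p n k"
  shows "dom p = n"
proof -
  have "x \<epsilon> n \<longleftrightarrow> (\<exists>y. opair x y \<epsilon> p)" for x
    using assms func_pair func_value by blast
  moreover from this have "x \<epsilon> dom p \<longleftrightarrow> (\<exists>y. opair x y \<epsilon> p)" for x
    unfolding dom_def by (intro in_set_of) blast
  ultimately show ?thesis by (intro extensionality) simp
qed

text \<open>
  A variant of \<open>fapply\<close> that is definable also outside the domain, where the value of \<open>THE\<close>
  is unspecified.
\<close>

definition value_at :: "'m \<Rightarrow> 'm \<Rightarrow> 'm" where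
  "value_at f x = (if \<exists>!y. opair x y \<epsilon> f then fapply f x else f)"

lemma value_at_eq [simp]: "func f a b \<Longrightarrow> x \<epsilon> a \<Longrightarrow> value_at f x = fapply f x"
  unfolding value_at_def func_def by simp

lemma dfun_value_at: "dfun t \<Longrightarrow> dfun u \<Longrightarrow> dfun (\<lambda>e. value_at (t e) (u e))"
proof (rule dfun_binary[of value_at])
  have "a = value_at f x \<longleftrightarrow>
      (opair x a \<epsilon> f \<and> (\<exists>!y. opair x y \<epsilon> f)) \<or> (\<not> (\<exists>!y. opair x y \<epsilon> f) \<and> a = f)" for a f x
  proof (cases "\<exists>!y. opair x y \<epsilon> f")
    case True
    then have "opair x (fapply f x) \<epsilon> f" unfolding fapply_def by (rule theI')
    with True show ?thesis unfolding value_at_def by auto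
  qed (simp add: value_at_def)
  then show "dfun (\<lambda>e. value_at (e 0) (e (Suc 0)))"
    unfolding dfun_def by (simp, intro definable_set_intros)
qed

subsection \<open>Induction and recursion on the integers\<close>

lemma definable_is_inductive: "definable (\<lambda>e. is_inductive (e i))"
  unfolding is_inductive_def by (intro definable_set_intros)

lemma in_omega: "n \<epsilon> omega \<longleftrightarrow> (\<forall>a. is_inductive a \<longrightarrow> n \<epsilon> a)"
proof -
  obtain a where "is_inductive a" using infinity by blast
  then show ?thesis unfolding omega_def
    by (intro in_set_of_bounded[of _ a])
      (intro definable_set_intros definable_is_inductive, blast)
qed

lemma empty_in_omega [simp]: "empty \<epsilon> omega"
  by (simp add: in_omega is_inductive_def)

lemma succ_in_omega [simp]: "n \<epsilon> omega \<Longrightarrow> succ n \<epsilon> omega"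
  by (simp add: in_omega is_inductive_def)

text \<open>\<open>omega\<close> may contain nonstandard elements, so only definable properties can
  be proved by induction: separation turns \<open>Q\<close> into an inductive subset of
  \<open>omega\<close>.\<close>

lemma omega_induct [consumes 2, case_names empty succ]:
  assumes "definable (\<lambda>e. Q (e 0))" "n \<epsilon> omega"
    and "Q empty" "\<And>n. n \<epsilon> omega \<Longrightarrow> Q n \<Longrightarrow> Q (succ n)"
  shows "Q n"
proof -
  obtain c where c: "\<And>x. x \<epsilon> c \<longleftrightarrow> x \<epsilon> omega \<and> Q x"
    using separation[OF assms(1), of omega] by blast
  then have "is_inductive c" using assms(3,4) by (simp add: is_inductive_def)
  then show ?thesis using c assms(2) in_omega by blast
qed

lemma omega_transitive:
  assumes "n \<epsilon> omega" "x \<epsilon> n"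
  shows "x \<epsilon> omega"
proof -
  have "definable (\<lambda>e. \<forall>x. x \<epsilon> e 0 \<longrightarrow> x \<epsilon> omega)" by (intro definable_set_intros)
  then have "\<forall>x. x \<epsilon> n \<longrightarrow> x \<epsilon> omega" using assms(1)
    by (induction n rule: omega_induct) auto
  then show ?thesis using assms(2) by blast
qed

lemma succ_ne_empty [simp]: "succ n \<noteq> empty" "empty \<noteq> succ n"
  by (metis in_empty in_succ)+

lemma succ_inject [simp]: "succ a = succ b \<longleftrightarrow> a = b"
proof
  assume eq: "succ a = succ b"
  show "a = b"
  proof (rule ccontr)
    assume "a \<noteq> b"
    then have "a \<epsilon> b" "b \<epsilon> a" using eq by (metis in_succ)+
    \<comment> \<open>The pair of \<open>a\<close> and \<open>b\<close> would have no minimal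
      element.\<close>
    then show False using regularity[of a "upair a b"] by auto
  qed
qed simp

text \<open>The function is the least relation that contains the initial pair and is closed under
  the step. Definability of \<open>s\<close> is what allows the intersection of all closed relations
  to be separated from the product of \<open>omega\<close> and \<open>T\<close>.\<close>

lemma recursion:
  assumes x0: "x0 \<epsilon> T" and s: "\<And>x. x \<epsilon> T \<Longrightarrow> s x \<epsilon> T" and ds: "dfun (\<lambda>e. s (e 0))"
  shows "\<exists>f. func f omega T \<and> fapply f empty = x0 \<and>
    (\<forall>n. n \<epsilon> omega \<longrightarrow> fapply f (succ n) = s (fapply f n))"
proof -
  define closed where "closed r \<longleftrightarrow> opair empty x0 \<epsilon> r \<and>
    (\<forall>n y. n \<epsilon> omega \<and> y \<epsilon> T \<and> opair n y \<epsilon> r \<longrightarrow> opair (succ n) (s y) \<epsilon> r)" for r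
  have "definable (\<lambda>e. \<forall>r. closed r \<longrightarrow> e 0 \<epsilon> r)"
    unfolding closed_def by (intro definable_set_intros dfun_unary[OF ds])
  from separation[OF this, of "cprod omega T"]
  obtain R where R: "\<And>w. w \<epsilon> R \<longleftrightarrow> w \<epsilon> cprod omega T \<and> (\<forall>r. closed r \<longrightarrow> w \<epsilon> r)" by blast
  have R0: "opair empty x0 \<epsilon> R" by (simp add: R x0 closed_def)
  have Rs: "opair (succ n) (s y) \<epsilon> R" if "opair n y \<epsilon> R" for n y
    using that s by (simp add: R closed_def)
  \<comment> \<open>Minimality of \<open>R\<close>: a pair \<open>w\<close> with no other origin
    could be deleted without destroying closure. The origin must differ from \<open>w\<close>
    because only pairs that survive the deletion have to be stepped.\<close>
  have removed: "w = opair empty x0 \<or>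
      (\<exists>n y. opair n y \<epsilon> R \<and> opair n y \<noteq> w \<and> w = opair (succ n) (s y))" if "w \<epsilon> R" for w
  proof (rule ccontr)
    assume neg: "\<not> ?thesis"
    have "definable (\<lambda>e. e 0 \<noteq> w)" by (intro definable_intros)
    from separation[OF this, of R] obtain r where r: "\<And>v. v \<epsilon> r \<longleftrightarrow> v \<epsilon> R \<and> v \<noteq> w" by blast
    then have "closed r" using R0 Rs neg unfolding closed_def by blast
    then show False using that R r by blast
  qed
  \<comment> \<open>By \<open>removed\<close>, a pair at \<open>empty\<close> is the initial one and
    a pair at \<open>succ n\<close> comes from a pair at \<open>n\<close>.\<close>
  have unique: "\<exists>!y. opair n y \<epsilon> R" if "n \<epsilon> omega" for n
  proof -
    have "definable (\<lambda>e. \<exists>!y. opair (e 0) y \<epsilon> R)" by (intro definable_set_intros)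
    then show ?thesis using that
    proof (induction n rule: omega_induct)
      case empty
      show ?case
      proof (rule ex1I[of _ x0], rule R0)
        show "y = x0" if "opair empty y \<epsilon> R" for y using removed[OF that] by simp
      qed
    next
      case (succ n)
      then obtain y where y: "opair n y \<epsilon> R" "\<And>y'. opair n y' \<epsilon> R \<Longrightarrow> y' = y" by blast
      show ?case
      proof (rule ex1I[of _ "s y"], rule Rs[OF y(1)])
        show "y' = s y" if "opair (succ n) y' \<epsilon> R" for y' using removed[OF that] y(2) by auto
      qed
    qed
  qed
  have "func R omega T"
    unfolding func_def using unique by (auto simp: R in_cprod)
  moreover from this have "fapply R empty = x0" "n \<epsilon> omega \<Longrightarrow> fapply R (succ n) = s (fapply R n)"
    for n using R0 Rs func_value func_pair by blast+
  ultimately show ?thesis by blast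
qed

section \<open>Numerals and execution\<close>

context
  fixes A :: "'m algebra"
  assumes app_func: "func (app_fun A) (cprod (Terms A) (Terms A)) (Terms A)"
    and instructions: "iB A \<epsilon> Terms A" "iI A \<epsilon> Terms A" "iK A \<epsilon> Terms A" "iW A \<epsilon> Terms A"
begin

lemma app_closed: "\<xi> \<epsilon> Terms A \<Longrightarrow> \<eta> \<epsilon> Terms A \<Longrightarrow> app A \<xi> \<eta> \<epsilon> Terms A"
  unfolding app_def by (rule func_in[OF app_func]) simp

text \<open>\<open>THE\<close> needs existence, from \<open>recursion\<close>, and uniqueness, from
  \<open>omega_induct\<close>. The assumptions of the context are such that they can be checked
  directly for the extended algebra too, so the result serves both algebras.\<close>

lemma numerals_spec:
  "func (numerals A) omega (Terms A) \<and> fapply (numerals A) empty = app A (iK A) (iI A) \<and>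
    (\<forall>n. n \<epsilon> omega \<longrightarrow> fapply (numerals A) (succ n) = app A (sigma A) (fapply (numerals A) n))"
proof -
  let ?P = "\<lambda>f. func f omega (Terms A) \<and> fapply f empty = app A (iK A) (iI A) \<and>
    (\<forall>n. n \<epsilon> omega \<longrightarrow> fapply f (succ n) = app A (sigma A) (fapply f n))"
  have sigma: "sigma A \<epsilon> Terms A"
    unfolding sigma_def by (intro app_closed instructions)
  have app_value_at: "value_at (app_fun A) (opair \<xi> \<eta>) = app A \<xi> \<eta>"
    if "\<xi> \<epsilon> Terms A" "\<eta> \<epsilon> Terms A" for \<xi> \<eta>
    unfolding app_def using app_func that by simp
  \<comment> \<open>\<open>recursion\<close> wants a definable step; \<open>value_at\<close>
    provides one that agrees with \<open>app A\<close> on terms.\<close>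
  let ?s = "\<lambda>x. value_at (app_fun A) (opair (sigma A) x)"
  have "\<exists>f. func f omega (Terms A) \<and> fapply f empty = app A (iK A) (iI A) \<and>
      (\<forall>n. n \<epsilon> omega \<longrightarrow> fapply f (succ n) = ?s (fapply f n))"
    by (rule recursion)
      (simp_all add: app_closed instructions sigma app_value_at dfun_value_at definable_set_intros)
  then obtain f where f: "func f omega (Terms A)" "fapply f empty = app A (iK A) (iI A)"
      "\<And>n. n \<epsilon> omega \<Longrightarrow> fapply f (succ n) = ?s (fapply f n)" by blast
  then have f: "?P f" using app_value_at[OF sigma func_in[OF f(1)]] by simp
  have "g = f" if g: "?P g" for g
  proof (rule func_eqI)
    show "func g omega (Terms A)" "func f omega (Terms A)" using f g by blast+
    fix n assume n: "n \<epsilon> omega"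
    have "definable (\<lambda>e. value_at g (e 0) = value_at f (e 0))"
      by (intro definable_set_intros dfun_value_at)
    then have "value_at g n = value_at f n" using n
      by (induction n rule: omega_induct)
        (use f g in \<open>simp_all add: value_at_eq[of _ omega "Terms A"]\<close>)
    then show "fapply g n = fapply f n" using f g n by (simp add: value_at_eq[of _ omega "Terms A"])
  qed
  with f have "\<exists>!f. ?P f" by blast
  then show ?thesis unfolding numerals_def by (rule theI')
qed

lemma numeral_of_empty: "numeral_of A empty = app A (iK A) (iI A)"
  using numerals_spec by (simp add: numeral_of_def)

lemma numeral_of_succ:
  "n \<epsilon> omega \<Longrightarrow> numeral_of A (succ n) = app A (sigma A) (numeral_of A n)"
  using numerals_spec by (simp add: numeral_of_def)

lemma numeral_of_closed: "n \<epsilon> omega \<Longrightarrow> numeral_of A n \<epsilon> Terms A"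
  using numerals_spec func_in by (auto simp: numeral_of_def)

text \<open>Execution steps ask for stacks; in the extended algebra this also splits an element of a
  falsity value into a stack of \<open>A\<close> and a condition.\<close>

lemma falsity_stacks:
  assumes "func (push_fun A) (cprod (Terms A) (Stacks A)) (Stacks A)"
  shows "\<pi> \<in> falsity A e F \<Longrightarrow> \<pi> \<epsilon> Stacks A"
proof -
  have push: "push A \<xi> \<pi> \<epsilon> Stacks A" if "\<xi> \<epsilon> Terms A" "\<pi> \<epsilon> Stacks A" for \<xi> \<pi>
    unfolding push_def by (rule func_in[OF assms]) (simp add: that)
  show "\<pi> \<in> falsity A e F \<Longrightarrow> \<pi> \<epsilon> Stacks A"
    by (induction F arbitrary: e \<pi>)
      (auto split: if_splits simp: orthogonal_def intro: push numeral_of_closed)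
qed

end

end

locale realizability_structure = zf_structure mem
  for mem :: "'m \<Rightarrow> 'm \<Rightarrow> bool" (infix "\<epsilon>" 50) +
  fixes A :: "'m algebra"
  assumes algebra: "realizability_algebra A"
begin

abbreviation app_A :: "'m \<Rightarrow> 'm \<Rightarrow> 'm" (infixl "\<bullet>" 70) where
  "\<xi> \<bullet> \<eta> \<equiv> app A \<xi> \<eta>"

abbreviation push_A :: "'m \<Rightarrow> 'm \<Rightarrow> 'm" (infixr "\<triangleright>" 65) where
  "\<xi> \<triangleright> \<pi> \<equiv> push A \<xi> \<pi>"

abbreviation in_pole :: "'m \<Rightarrow> 'm \<Rightarrow> bool" (infix "\<star>" 60) where
  "\<xi> \<star> \<pi> \<equiv> process A \<xi> \<pi> \<epsilon> pole A"

abbreviation "trm \<xi> \<equiv> \<xi> \<epsilon> Terms A"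

abbreviation "stk \<pi> \<equiv> \<pi> \<epsilon> Stacks A"

abbreviation "prf \<theta> \<equiv> \<theta> \<epsilon> QP A"

section \<open>Closure properties and anti-execution in the given algebra\<close>

lemma operations_func:
  "func (app_fun A) (cprod (Terms A) (Terms A)) (Terms A)"
  "func (push_fun A) (cprod (Terms A) (Stacks A)) (Stacks A)"
  "func (process_fun A) (cprod (Terms A) (Stacks A)) (Processes A)"
  using algebra unfolding realizability_algebra_def by simp_all

lemma prf_instructions [simp]:
  "prf (iB A)" "prf (iC A)" "prf (iI A)" "prf (iK A)" "prf (iW A)"
  using algebra unfolding realizability_algebra_def by simp_all

lemma prf_app [simp]: "prf \<theta> \<Longrightarrow> prf \<theta>' \<Longrightarrow> prf (\<theta> \<bullet> \<theta>')"
  using algebra unfolding realizability_algebra_def by simp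

lemma prf_trm: "prf \<theta> \<Longrightarrow> trm \<theta>"
  using algebra unfolding realizability_algebra_def subset_of_def by blast

lemma trm_instructions [simp]:
  "trm (iB A)" "trm (iC A)" "trm (iI A)" "trm (iK A)" "trm (iW A)"
  by (simp_all add: prf_trm)

lemma trm_app [simp]: "trm \<xi> \<Longrightarrow> trm \<eta> \<Longrightarrow> trm (\<xi> \<bullet> \<eta>)"
  unfolding app_def by (rule func_in[OF operations_func(1)]) simp

lemma stk_push [simp]: "trm \<xi> \<Longrightarrow> stk \<pi> \<Longrightarrow> stk (\<xi> \<triangleright> \<pi>)"
  unfolding push_def by (rule func_in[OF operations_func(2)]) simp

lemma process_closed: "trm \<xi> \<Longrightarrow> stk \<pi> \<Longrightarrow> process A \<xi> \<pi> \<epsilon> Processes A"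
  unfolding process_def by (rule func_in[OF operations_func(3)]) simp

lemma pole_exec1: "exec1 A s s' \<Longrightarrow> s' \<epsilon> pole A \<Longrightarrow> s \<epsilon> pole A"
  using algebra unfolding realizability_algebra_def exec_def by blast

lemma pole_app: "\<xi> \<star> \<eta> \<triangleright> \<pi> \<Longrightarrow> trm \<xi> \<Longrightarrow> trm \<eta> \<Longrightarrow> stk \<pi> \<Longrightarrow> \<xi> \<bullet> \<eta> \<star> \<pi>"
  by (rule pole_exec1[OF exec_app])

lemma pole_I: "\<xi> \<star> \<pi> \<Longrightarrow> trm \<xi> \<Longrightarrow> stk \<pi> \<Longrightarrow> iI A \<star> \<xi> \<triangleright> \<pi>"
  by (rule pole_exec1[OF exec_I])

lemma pole_K: "\<xi> \<star> \<pi> \<Longrightarrow> trm \<xi> \<Longrightarrow> trm \<eta> \<Longrightarrow> stk \<pi> \<Longrightarrow> iK A \<star> \<xi> \<triangleright> \<eta> \<triangleright> \<pi>"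
  by (rule pole_exec1[OF exec_K])

lemma pole_W:
  "\<xi> \<star> \<eta> \<triangleright> \<eta> \<triangleright> \<pi> \<Longrightarrow> trm \<xi> \<Longrightarrow> trm \<eta> \<Longrightarrow> stk \<pi> \<Longrightarrow> iW A \<star> \<xi> \<triangleright> \<eta> \<triangleright> \<pi>"
  by (rule pole_exec1[OF exec_W])

lemma pole_C: "\<xi> \<star> \<zeta> \<triangleright> \<eta> \<triangleright> \<pi> \<Longrightarrow> trm \<xi> \<Longrightarrow> trm \<eta> \<Longrightarrow> trm \<zeta> \<Longrightarrow> stk \<pi> \<Longrightarrow>
    iC A \<star> \<xi> \<triangleright> \<eta> \<triangleright> \<zeta> \<triangleright> \<pi>"
  by (rule pole_exec1[OF exec_C])

lemma pole_B: "\<xi> \<star> (\<eta> \<bullet> \<zeta>) \<triangleright> \<pi> \<Longrightarrow> trm \<xi> \<Longrightarrow> trm \<eta> \<Longrightarrow> trm \<zeta> \<Longrightarrow> stk \<pi> \<Longrightarrow>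
    iB A \<star> \<xi> \<triangleright> \<eta> \<triangleright> \<zeta> \<triangleright> \<pi>"
  by (rule pole_exec1[OF exec_B])

text \<open>Used backwards, these rules execute the process in the goal step by step.\<close>

lemmas pole_intros = pole_app pole_I pole_K pole_W pole_C pole_B

subsection \<open>Abstraction\<close>

text \<open>In contrast to \<open>cterm_val\<close>, variables have values here, so that arbitrary
  terms, in particular proof-like ones, can be plugged into an abstraction.\<close>

primrec cval :: "(nat \<Rightarrow> 'm) \<Rightarrow> cterm \<Rightarrow> 'm" where
  "cval v (CVar x) = v x"
| "cval v CB = iB A"
| "cval v CC = iC A"
| "cval v CI = iI A"
| "cval v CK = iK A"
| "cval v CW = iW A"
| "cval v Ccc = icc A"
| "cval v (t \<cdot> u) = cval v t \<bullet> cval v u"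

text \<open>
  The process reached from \<open>t \<star> \<pi>\<close> by pushing the arguments of the head of \<open>t\<close> belongs to the
  pole. Since the pole is only closed under anti-execution, iterated abstractions are treated in
  this form.
\<close>

primrec unwind :: "cterm \<Rightarrow> (nat \<Rightarrow> 'm) \<Rightarrow> 'm \<Rightarrow> bool" where
  "unwind (CVar x) v \<pi> \<longleftrightarrow> v x \<star> \<pi>"
| "unwind CB v \<pi> \<longleftrightarrow> iB A \<star> \<pi>"
| "unwind CC v \<pi> \<longleftrightarrow> iC A \<star> \<pi>"
| "unwind CI v \<pi> \<longleftrightarrow> iI A \<star> \<pi>"
| "unwind CK v \<pi> \<longleftrightarrow> iK A \<star> \<pi>"
| "unwind CW v \<pi> \<longleftrightarrow> iW A \<star> \<pi>"
| "unwind Ccc v \<pi> \<longleftrightarrow> icc A \<star> \<pi>"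
| "unwind (t \<cdot> u) v \<pi> \<longleftrightarrow> unwind t v (cval v u \<triangleright> \<pi>)"

lemma cval_prf: "(\<And>i. prf (v i)) \<Longrightarrow> prf (cval v t)"
  using algebra by (induction t) (simp_all add: realizability_algebra_def)

lemma cval_trm: "(\<And>i. trm (v i)) \<Longrightarrow> trm (cval v t)"
  using algebra prf_trm by (induction t) (simp_all add: realizability_algebra_def)

lemma cval_upd: "\<not> occurs x t \<Longrightarrow> cval (v(x := a)) t = cval v t"
  by (induction t) auto

lemma unwind_upd: "\<not> occurs x t \<Longrightarrow> unwind t (v(x := a)) \<pi> \<longleftrightarrow> unwind t v \<pi>"
  by (induction t arbitrary: \<pi>) (auto simp: cval_upd)

lemma unwind_in_pole: "(\<And>i. trm (v i)) \<Longrightarrow> stk \<pi> \<Longrightarrow> unwind t v \<pi> \<Longrightarrow> cval v t \<star> \<pi>"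
  by (induction t arbitrary: \<pi>) (auto intro!: pole_app simp: cval_trm)

text \<open>The induction follows the translation rules: each rule puts one of \<open>K\<close>,
  \<open>I\<close>, \<open>C\<close>, \<open>W\<close>, \<open>B\<close> in front, and one step of
  that instruction leads back to the body, except for the eta rule, which needs no step.\<close>

lemma unwind_abstr:
  assumes "\<And>i. trm (v i)" "trm a"
  shows "stk \<pi> \<Longrightarrow> unwind t (v(x := a)) \<pi> \<Longrightarrow> unwind (abstr x t) v (a \<triangleright> \<pi>)"
proof (induction x t arbitrary: \<pi> rule: abstr.induct)
  case (1 x t)
  have v': "trm ((v(x := a)) i)" for i using assms by simp
  show ?case
  proof (cases "occurs x t")
    case False
    then have "unwind t v \<pi>" using "1.prems"(2) unwind_upd by blast
    then show ?thesis using False assms "1.prems"(1)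
      by (subst abstr.simps) (simp add: pole_K unwind_in_pole cval_trm)
  next
    case occ: True
    show ?thesis
    proof (cases t)
      case (CVar y)
      then show ?thesis using occ assms "1.prems" by (subst abstr.simps) (simp add: pole_I)
    next
      case t: (CApp t1 u)
      show ?thesis
      proof (cases "occurs x u")
        case False
        have "unwind t1 (v(x := a)) (cval v u \<triangleright> \<pi>)"
          using "1.prems"(2) unfolding t unwind.simps cval_upd[OF False] .
        moreover have "stk (cval v u \<triangleright> \<pi>)" using "1.prems"(1) assms(1) by (simp add: cval_trm)
        ultimately have "unwind (abstr x t1) v (a \<triangleright> cval v u \<triangleright> \<pi>)"
          using 1(1) occ t False by blast
        then show ?thesis using occ False assms "1.prems"(1)
          by (subst abstr.simps) (simp add: t pole_C unwind_in_pole cval_trm)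
      next
        case occ_u: True
        show ?thesis
        proof (cases "\<exists>u1 w. u = u1 \<cdot> w")
          case True
          then obtain u1 w where u: "u = u1 \<cdot> w" by blast
          \<comment> \<open>One step of \<open>B\<close> leads from the regrouped term to the
            original application.\<close>
          have "unwind (CB \<cdot> t1 \<cdot> u1 \<cdot> w) (v(x := a)) \<pi>"
            using "1.prems" by (simp add: t u pole_B unwind_in_pole cval_trm v' del: fun_upd_apply)
          then have "unwind (abstr x (CB \<cdot> t1 \<cdot> u1 \<cdot> w)) v (a \<triangleright> \<pi>)"
            using 1(9) occ t occ_u u "1.prems"(1) by blast
          then show ?thesis using occ occ_u by (subst abstr.simps) (simp add: t u)
        next
          case False
          then have u: "u = CVar x" using occ_u by (cases u) auto
          show ?thesis
          proof (cases "occurs x t1")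
            case True
            have "unwind (abstr x t1) v (a \<triangleright> a \<triangleright> \<pi>)"
              using 1(2) occ t occ_u True u "1.prems" assms(2) by simp
            then show ?thesis using occ True assms "1.prems"(1)
              by (subst abstr.simps) (simp add: t u pole_W unwind_in_pole cval_trm)
          next
            case False
            \<comment> \<open>The eta rule: the abstraction is \<open>t1\<close> itself, already
              applied to \<open>a\<close>.\<close>
            have "unwind t1 (v(x := a)) (a \<triangleright> \<pi>)" using "1.prems"(2) by (simp add: t u del: fun_upd_apply) simp
            then show ?thesis using occ False
              by (subst abstr.simps) (simp add: t u unwind_upd[OF False] del: fun_upd_apply)
          qed
        qed
      qed
    qed (use occ in simp_all)
  qed
qed

lemma abstr2_in_pole:
  assumes "\<And>i. trm (v i)" "trm a" "trm b" "stk \<pi>" "unwind t (v(0 := a, 1 := b)) \<pi>"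
  shows "cval v (abstr 0 (abstr 1 t)) \<star> a \<triangleright> b \<triangleright> \<pi>"
  by (rule unwind_in_pole) (use assms in \<open>auto intro!: unwind_abstr\<close>)

lemma abstr3_in_pole:
  assumes "\<And>i. trm (v i)" "trm a" "trm b" "trm c" "stk \<pi>"
    "unwind t (v(0 := a, 1 := b, 2 := c)) \<pi>"
  shows "cval v (abstr 0 (abstr 1 (abstr 2 t))) \<star> a \<triangleright> b \<triangleright> c \<triangleright> \<pi>"
  by (rule unwind_in_pole) (use assms in \<open>auto intro!: unwind_abstr\<close>)

section \<open>Integers of the given algebra and proof-like terms from open combinatory
  terms\<close>

lemmas A_numerals = numerals_spec[OF operations_func(1) trm_instructions(1,3,4,5)]
lemmas A_numeral_empty = numeral_of_empty[OF operations_func(1) trm_instructions(1,3,4,5)]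
lemmas A_numeral_succ = numeral_of_succ[OF operations_func(1) trm_instructions(1,3,4,5)]
lemmas trm_numeral [simp] = numeral_of_closed[OF operations_func(1) trm_instructions(1,3,4,5)]

text \<open>Variables from 0 on are the abstracted arguments, while 3, 4 and 5 hold proof-like
  constants. All other variables get \<open>I\<close>, merely so that every value is proof-like and
  \<open>cval_prf\<close> applies.\<close>

lemma combinator2:
  assumes "prf x" "prf y" "prf w"
  obtains \<theta> where "prf \<theta>"
    "\<And>a b \<pi>. trm a \<Longrightarrow> trm b \<Longrightarrow> stk \<pi> \<Longrightarrow>
      unwind t ((\<lambda>_. iI A)(3 := x, 4 := y, 5 := w, 0 := a, 1 := b)) \<pi> \<Longrightarrow> \<theta> \<star> a \<triangleright> b \<triangleright> \<pi>"
proof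
  let ?v = "(\<lambda>_. iI A)(3 := x, 4 := y, 5 := w)"
  show "prf (cval ?v (abstr 0 (abstr 1 t)))" using assms by (intro cval_prf) simp
  show "cval ?v (abstr 0 (abstr 1 t)) \<star> a \<triangleright> b \<triangleright> \<pi>"
    if "trm a" "trm b" "stk \<pi>" "unwind t (?v(0 := a, 1 := b)) \<pi>" for a b \<pi>
    using that assms by (intro abstr2_in_pole) (simp_all add: prf_trm)
qed

lemma combinator3:
  assumes "prf x" "prf y" "prf w"
  obtains \<theta> where "prf \<theta>"
    "\<And>a b c \<pi>. trm a \<Longrightarrow> trm b \<Longrightarrow> trm c \<Longrightarrow> stk \<pi> \<Longrightarrow>
      unwind t ((\<lambda>_. iI A)(3 := x, 4 := y, 5 := w, 0 := a, 1 := b, 2 := c)) \<pi> \<Longrightarrow>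
      \<theta> \<star> a \<triangleright> b \<triangleright> c \<triangleright> \<pi>"
proof
  let ?v = "(\<lambda>_. iI A)(3 := x, 4 := y, 5 := w)"
  show "prf (cval ?v (abstr 0 (abstr 1 (abstr 2 t))))" using assms by (intro cval_prf) simp
  show "cval ?v (abstr 0 (abstr 1 (abstr 2 t))) \<star> a \<triangleright> b \<triangleright> c \<triangleright> \<pi>"
    if "trm a" "trm b" "trm c" "stk \<pi>" "unwind t (?v(0 := a, 1 := b, 2 := c)) \<pi>" for a b c \<pi>
    using that assms by (intro abstr3_in_pole) (simp_all add: prf_trm)
qed

text \<open>The Church successor: the iterations of \<open>\<phi>\<close> accumulate on the
  continuation \<open>\<gamma>\<close>, which is what a storage operator exploits.\<close>

lemma sigma_in_pole:
  assumes "\<nu> \<star> \<phi> \<triangleright> (\<phi> \<bullet> \<gamma>) \<triangleright> \<pi>" "trm \<nu>" "trm \<phi>" "trm \<gamma>" "stk \<pi>"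
  shows "sigma A \<bullet> \<nu> \<star> \<phi> \<triangleright> \<gamma> \<triangleright> \<pi>"
  unfolding sigma_def
  by (intro pole_intros assms trm_app stk_push trm_instructions)

lemma zero_in_pole:
  assumes "\<gamma> \<star> \<pi>" "trm \<phi>" "trm \<gamma>" "stk \<pi>"
  shows "iK A \<bullet> iI A \<star> \<phi> \<triangleright> \<gamma> \<triangleright> \<pi>"
  by (intro pole_intros assms trm_app stk_push trm_instructions)

lemma prf_sigma [simp]: "prf (sigma A)"
  by (simp add: sigma_def)

subsection \<open>The instructions of the extended algebra\<close>

abbreviation "B_ext \<equiv> cterm_val A B_star"
abbreviation "I_ext \<equiv> cterm_val A I_star"
abbreviation "K_ext \<equiv> cterm_val A K_star"
abbreviation "W_ext \<equiv> cterm_val A W_star"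

lemma B_star_eq: "B_star = CC \<cdot> (CB \<cdot> CC \<cdot> (CC \<cdot> (CB \<cdot> (CB \<cdot> CB \<cdot> CB)))) \<cdot> CC"
  by (simp add: B_star_def abstr.simps)

lemma prf_ext [simp]: "prf B_ext" "prf I_ext" "prf K_ext" "prf W_ext"
  by (simp_all add: B_star_eq I_star_def K_star_def W_star_def)

lemma trm_ext [simp]: "trm B_ext" "trm I_ext" "trm K_ext" "trm W_ext"
  by (simp_all add: prf_trm)

text \<open>\<open>\<nu>\<close> is the integer on top of an extended stack. Below it the
  instruction acts as \<open>B\<close> with extended application \<open>C \<eta> \<zeta>\<close>,
  and the new head receives \<open>\<nu>\<close> unchanged; \<open>I_ext\<close>,
  \<open>K_ext\<close> and \<open>W_ext\<close> follow the same pattern.\<close>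

lemma pole_B_ext:
  assumes "\<xi> \<star> \<nu> \<triangleright> (iC A \<bullet> \<eta> \<bullet> \<zeta>) \<triangleright> \<pi>" "trm \<nu>" "trm \<xi>" "trm \<eta>" "trm \<zeta>" "stk \<pi>"
  shows "B_ext \<star> \<nu> \<triangleright> \<xi> \<triangleright> \<eta> \<triangleright> \<zeta> \<triangleright> \<pi>"
  unfolding B_star_eq cterm_val.simps
  by (intro pole_intros assms trm_app stk_push trm_instructions)

lemma pole_I_ext: "\<xi> \<star> \<nu> \<triangleright> \<pi> \<Longrightarrow> trm \<nu> \<Longrightarrow> trm \<xi> \<Longrightarrow> stk \<pi> \<Longrightarrow> I_ext \<star> \<nu> \<triangleright> \<xi> \<triangleright> \<pi>"
  unfolding I_star_def cterm_val.simps
  by (intro pole_intros trm_app stk_push trm_instructions)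

lemma pole_K_ext:
  assumes "\<xi> \<star> \<nu> \<triangleright> \<pi>" "trm \<nu>" "trm \<xi>" "trm \<eta>" "stk \<pi>"
  shows "K_ext \<star> \<nu> \<triangleright> \<xi> \<triangleright> \<eta> \<triangleright> \<pi>"
  unfolding K_star_def cterm_val.simps
  by (intro pole_intros assms trm_app stk_push trm_instructions)

lemma pole_W_ext:
  assumes "\<xi> \<star> \<nu> \<triangleright> \<eta> \<triangleright> \<eta> \<triangleright> \<pi>" "trm \<nu>" "trm \<xi>" "trm \<eta>" "stk \<pi>"
  shows "W_ext \<star> \<nu> \<triangleright> \<xi> \<triangleright> \<eta> \<triangleright> \<pi>"
  unfolding W_star_def cterm_val.simps
  by (intro pole_intros assms trm_app stk_push trm_instructions)

text \<open>This is the first component of \<open>sigma B\<close>: every application in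
  \<open>sigma\<close> becomes a use of \<open>C\<close>.\<close>

definition sigma_ext :: 'm where
  "sigma_ext = iC A \<bullet> (iC A \<bullet> B_ext \<bullet> W_ext) \<bullet> (iC A \<bullet> B_ext \<bullet> B_ext)"

lemma prf_sigma_ext [simp]: "prf sigma_ext"
  by (simp add: sigma_ext_def)

lemma trm_sigma_ext [simp]: "trm sigma_ext"
  by (simp add: prf_trm)

lemma sigma_ext_in_pole:
  assumes "\<nu> \<star> \<mu> \<triangleright> \<phi> \<triangleright> (iC A \<bullet> \<phi> \<bullet> \<gamma>) \<triangleright> \<pi>" "trm \<nu>" "trm \<mu>" "trm \<phi>" "trm \<gamma>" "stk \<pi>"
  shows "iC A \<bullet> sigma_ext \<bullet> \<nu> \<star> \<mu> \<triangleright> \<phi> \<triangleright> \<gamma> \<triangleright> \<pi>"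
  unfolding sigma_ext_def
  by (intro pole_B_ext pole_W_ext pole_app pole_C assms trm_app stk_push trm_instructions trm_ext)

lemma zero_ext_in_pole:
  assumes "\<gamma> \<star> \<mu> \<triangleright> \<pi>" "trm \<mu>" "trm \<phi>" "trm \<gamma>" "stk \<pi>"
  shows "iC A \<bullet> K_ext \<bullet> I_ext \<star> \<mu> \<triangleright> \<phi> \<triangleright> \<gamma> \<triangleright> \<pi>"
  by (intro pole_K_ext pole_I_ext pole_app pole_C assms trm_app stk_push trm_instructions trm_ext)

lemma app_value_at: "trm \<xi> \<Longrightarrow> trm \<eta> \<Longrightarrow> value_at (app_fun A) (opair \<xi> \<eta>) = \<xi> \<bullet> \<eta>"
  by (simp add: app_def value_at_eq[OF operations_func(1)])

lemma push_value_at: "trm \<xi> \<Longrightarrow> stk \<pi> \<Longrightarrow> value_at (push_fun A) (opair \<xi> \<pi>) = \<xi> \<triangleright> \<pi>"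
  by (simp add: push_def value_at_eq[OF operations_func(2)])

lemma process_value_at:
  "trm \<xi> \<Longrightarrow> stk \<pi> \<Longrightarrow> value_at (process_fun A) (opair \<xi> \<pi>) = process A \<xi> \<pi>"
  by (simp add: process_def value_at_eq[OF operations_func(3)])

text \<open>The first components of the integers of the extended algebra.\<close>

lemma ext_numerals_exist:
  "\<exists>f. func f omega (Terms A) \<and> fapply f empty = iC A \<bullet> K_ext \<bullet> I_ext \<and>
    (\<forall>n. n \<epsilon> omega \<longrightarrow> fapply f (succ n) = iC A \<bullet> sigma_ext \<bullet> fapply f n)"
proof -
  let ?s = "\<lambda>x. value_at (app_fun A) (opair (iC A \<bullet> sigma_ext) x)"
  have "\<exists>f. func f omega (Terms A) \<and> fapply f empty = iC A \<bullet> K_ext \<bullet> I_ext \<and>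
      (\<forall>n. n \<epsilon> omega \<longrightarrow> fapply f (succ n) = ?s (fapply f n))"
    by (rule recursion) (simp_all add: app_value_at dfun_value_at definable_set_intros)
  then obtain f where f: "func f omega (Terms A)" "fapply f empty = iC A \<bullet> K_ext \<bullet> I_ext"
      "\<And>n. n \<epsilon> omega \<Longrightarrow> fapply f (succ n) = ?s (fapply f n)" by blast
  moreover have "?s (fapply f n) = iC A \<bullet> sigma_ext \<bullet> fapply f n" if "n \<epsilon> omega" for n
    using func_in[OF f(1) that] by (simp add: app_value_at)
  ultimately show ?thesis by auto
qed

definition ext_numerals :: 'm where
  "ext_numerals = (SOME f. func f omega (Terms A) \<and> fapply f empty = iC A \<bullet> K_ext \<bullet> I_ext \<and>
    (\<forall>n. n \<epsilon> omega \<longrightarrow> fapply f (succ n) = iC A \<bullet> sigma_ext \<bullet> fapply f n))"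

lemma ext_numerals:
  "func ext_numerals omega (Terms A)"
  "fapply ext_numerals empty = iC A \<bullet> K_ext \<bullet> I_ext"
  "n \<epsilon> omega \<Longrightarrow> fapply ext_numerals (succ n) = iC A \<bullet> sigma_ext \<bullet> fapply ext_numerals n"
  using someI_ex[OF ext_numerals_exist] unfolding ext_numerals_def by blast+

lemma trm_ext_numeral [simp]: "n \<epsilon> omega \<Longrightarrow> trm (fapply ext_numerals n)"
  by (rule func_in[OF ext_numerals(1)])

subsection \<open>Storage operators\<close>

text \<open>
  The integers may be nonstandard, so the induction has to take place inside the model, on a
  definable property.
\<close>

lemma numeral_store:
  assumes \<phi>: "trm \<phi>"
    and step: "\<And>\<gamma> \<xi> \<pi>. trm \<gamma> \<Longrightarrow> trm \<xi> \<Longrightarrow> stk \<pi> \<Longrightarrow> \<gamma> \<star> (iC A \<bullet> sigma_ext \<bullet> \<xi>) \<triangleright> \<pi> \<Longrightarrow>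
      \<phi> \<star> \<gamma> \<triangleright> \<xi> \<triangleright> \<pi>"
    and n: "n \<epsilon> omega"
    and goal: "trm \<gamma>" "stk \<pi>" "\<gamma> \<star> fapply ext_numerals n \<triangleright> \<pi>"
  shows "numeral_of A n \<star> \<phi> \<triangleright> \<gamma> \<triangleright> fapply ext_numerals empty \<triangleright> \<pi>"
proof -
  \<comment> \<open>All operations are written with \<open>value_at\<close> to make the property
    definable. It quantifies over \<open>\<gamma>\<close> and \<open>\<pi>\<close> because the
    induction step replaces \<open>\<gamma>\<close> by
    \<open>\<phi> \<bullet> \<gamma>\<close>.\<close>
  let ?Q = "\<lambda>n. \<forall>\<gamma> \<pi>. trm \<gamma> \<longrightarrow> stk \<pi> \<longrightarrow> value_at (process_fun A)
      (opair \<gamma> (value_at (push_fun A) (opair (value_at ext_numerals n) \<pi>))) \<epsilon> pole A \<longrightarrow>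
    value_at (process_fun A) (opair (value_at (numerals A) n) (value_at (push_fun A)
      (opair \<phi> (value_at (push_fun A) (opair \<gamma> (value_at (push_fun A)
        (opair (fapply ext_numerals empty) \<pi>))))))) \<epsilon> pole A"
  have value_at_numerals: "value_at (numerals A) k = numeral_of A k"
    "value_at ext_numerals k = fapply ext_numerals k" if "k \<epsilon> omega" for k
    using that A_numerals ext_numerals(1) by (auto simp: numeral_of_def)
  have Q: "?Q k \<longleftrightarrow> (\<forall>\<gamma> \<pi>. trm \<gamma> \<longrightarrow> stk \<pi> \<longrightarrow> \<gamma> \<star> fapply ext_numerals k \<triangleright> \<pi> \<longrightarrow>
      numeral_of A k \<star> \<phi> \<triangleright> \<gamma> \<triangleright> fapply ext_numerals empty \<triangleright> \<pi>)" if "k \<epsilon> omega" for k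
    using that \<phi> by (simp add: value_at_numerals push_value_at process_value_at)
  have "definable (\<lambda>e. ?Q (e 0))"
    by (intro definable_set_intros dfun_value_at)
  then have "?Q n" using n
  proof (induction n rule: omega_induct)
    case empty
    show ?case using \<phi> by (simp only: Q empty_in_omega) (simp add: A_numeral_empty zero_in_pole)
  next
    case (succ n)
    have "numeral_of A (succ n) \<star> \<phi> \<triangleright> \<gamma> \<triangleright> fapply ext_numerals empty \<triangleright> \<pi>"
      if "trm \<gamma>" "stk \<pi>" "\<gamma> \<star> fapply ext_numerals (succ n) \<triangleright> \<pi>" for \<gamma> \<pi>
    proof -
      \<comment> \<open>One \<open>\<phi>\<close> turns the stored integer \<open>n\<close> into
        \<open>succ n\<close> before calling \<open>\<gamma>\<close>, so
        \<open>\<phi> \<bullet> \<gamma>\<close> is a valid continuation for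
        \<open>n\<close>.\<close>
      have "\<phi> \<bullet> \<gamma> \<star> fapply ext_numerals n \<triangleright> \<pi>"
        using that succ(1) \<phi> by (intro pole_app step) (simp_all add: ext_numerals(3))
      then have "numeral_of A n \<star> \<phi> \<triangleright> (\<phi> \<bullet> \<gamma>) \<triangleright> fapply ext_numerals empty \<triangleright> \<pi>"
        using succ that(1,2) \<phi> by (simp only: Q) simp
      then show ?thesis using succ(1) that(1,2) \<phi>
        by (simp add: A_numeral_succ sigma_in_pole)
    qed
    then show ?case using succ(1) by (simp only: Q succ_in_omega) blast
  qed
  then show ?thesis using goal n by (simp only: Q)
qed

text \<open>The mirror image of \<open>numeral_store\<close>. An extended integer runs with a bound
  \<open>\<mu>\<close> on top, which is only handed on and hence stays fixed in the induction;
  continuations are now composed by extended application.\<close>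

lemma ext_numeral_store:
  assumes \<phi>: "trm \<phi>"
    and step: "\<And>\<mu> \<gamma> \<xi> \<pi>. trm \<mu> \<Longrightarrow> trm \<gamma> \<Longrightarrow> trm \<xi> \<Longrightarrow> stk \<pi> \<Longrightarrow>
      \<gamma> \<star> \<mu> \<triangleright> (sigma A \<bullet> \<xi>) \<triangleright> \<pi> \<Longrightarrow> \<phi> \<star> \<mu> \<triangleright> \<gamma> \<triangleright> \<xi> \<triangleright> \<pi>"
    and n: "n \<epsilon> omega"
    and goal: "trm \<mu>" "trm \<gamma>" "stk \<pi>" "\<gamma> \<star> \<mu> \<triangleright> numeral_of A n \<triangleright> \<pi>"
  shows "fapply ext_numerals n \<star> \<mu> \<triangleright> \<phi> \<triangleright> \<gamma> \<triangleright> numeral_of A empty \<triangleright> \<pi>"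
proof -
  let ?Q = "\<lambda>n. \<forall>\<gamma> \<pi>. trm \<gamma> \<longrightarrow> stk \<pi> \<longrightarrow> value_at (process_fun A)
      (opair \<gamma> (value_at (push_fun A) (opair \<mu>
        (value_at (push_fun A) (opair (value_at (numerals A) n) \<pi>))))) \<epsilon> pole A \<longrightarrow>
    value_at (process_fun A) (opair (value_at ext_numerals n) (value_at (push_fun A)
      (opair \<mu> (value_at (push_fun A) (opair \<phi> (value_at (push_fun A) (opair \<gamma>
        (value_at (push_fun A) (opair (numeral_of A empty) \<pi>))))))))) \<epsilon> pole A"
  have value_at_numerals: "value_at (numerals A) k = numeral_of A k"
    "value_at ext_numerals k = fapply ext_numerals k" if "k \<epsilon> omega" for k
    using that A_numerals ext_numerals(1) by (auto simp: numeral_of_def)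
  have Q: "?Q k \<longleftrightarrow> (\<forall>\<gamma> \<pi>. trm \<gamma> \<longrightarrow> stk \<pi> \<longrightarrow> \<gamma> \<star> \<mu> \<triangleright> numeral_of A k \<triangleright> \<pi> \<longrightarrow>
      fapply ext_numerals k \<star> \<mu> \<triangleright> \<phi> \<triangleright> \<gamma> \<triangleright> numeral_of A empty \<triangleright> \<pi>)" if "k \<epsilon> omega" for k
    using that \<phi> goal(1) by (simp add: value_at_numerals push_value_at process_value_at)
  have "definable (\<lambda>e. ?Q (e 0))"
    by (intro definable_set_intros dfun_value_at)
  then have "?Q n" using n
  proof (induction n rule: omega_induct)
    case empty
    show ?case using \<phi> goal(1)
      by (simp only: Q empty_in_omega) (simp add: ext_numerals(2) zero_ext_in_pole)
  next
    case (succ n)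
    have "fapply ext_numerals (succ n) \<star> \<mu> \<triangleright> \<phi> \<triangleright> \<gamma> \<triangleright> numeral_of A empty \<triangleright> \<pi>"
      if "trm \<gamma>" "stk \<pi>" "\<gamma> \<star> \<mu> \<triangleright> numeral_of A (succ n) \<triangleright> \<pi>" for \<gamma> \<pi>
    proof -
      have "iC A \<bullet> \<phi> \<bullet> \<gamma> \<star> \<mu> \<triangleright> numeral_of A n \<triangleright> \<pi>"
        using that succ(1) \<phi> goal(1)
        by (intro pole_app pole_C step) (simp_all add: A_numeral_succ)
      then have "fapply ext_numerals n \<star> \<mu> \<triangleright> \<phi> \<triangleright> (iC A \<bullet> \<phi> \<bullet> \<gamma>) \<triangleright> numeral_of A empty \<triangleright> \<pi>"
        using succ that(1,2) \<phi> by (simp only: Q) simp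
      then show ?thesis using succ(1) that(1,2) \<phi> goal(1)
        by (simp add: ext_numerals(3) sigma_ext_in_pole)
    qed
    then show ?case using succ(1) by (simp only: Q succ_in_omega) blast
  qed
  then show ?thesis using goal n by (simp only: Q)
qed

end

section \<open>The extended algebra\<close>

locale forcing_extension = realizability_structure mem A
  for mem :: "'m \<Rightarrow> 'm \<Rightarrow> bool" (infix "\<epsilon>" 50) and A :: "'m algebra" +
  fixes \<kappa> z b :: 'm
  assumes z: "\<not> z \<epsilon> fin_seqs \<kappa>"
    and pole: "extended_pole A \<kappa> z b"
begin

section \<open>Conditions and their products\<close>

abbreviation "P \<equiv> conditions \<kappa> z"

abbreviation "cond p \<equiv> p \<epsilon> conditions \<kappa> z"

abbreviation "B \<equiv> extended_algebra A \<kappa> z b"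

lemma in_fin_seqs: "p \<epsilon> fin_seqs \<kappa> \<longleftrightarrow> (\<exists>n. n \<epsilon> omega \<and> func p n \<kappa>)"
proof -
  \<comment> \<open>Finite sequences are subsets of the product of \<open>omega\<close> and
    \<open>\<kappa>\<close>, since integers are subsets of \<open>omega\<close>.\<close>
  obtain c where c: "\<And>x. x \<epsilon> c \<longleftrightarrow> subset_of x (cprod omega \<kappa>)" using powerset by blast
  show ?thesis unfolding fin_seqs_def
  proof (rule in_set_of_bounded)
    show "definable (\<lambda>e. \<exists>n. n \<epsilon> omega \<and> func (e 0) n \<kappa>)"
      unfolding func_def by (intro definable_set_intros)
    show "p \<epsilon> c" if "\<exists>n. n \<epsilon> omega \<and> func p n \<kappa>" for p
    proof -
      from that obtain n where "n \<epsilon> omega" "func p n \<kappa>" by blast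
      then have "x \<epsilon> cprod omega \<kappa>" if "x \<epsilon> p" for x
        using that in_func func_in omega_transitive by (auto simp: in_cprod)
      then show ?thesis by (simp add: c subset_of_def)
    qed
  qed
qed

lemma func_empty: "func empty empty \<kappa>"
  by (simp add: func_def)

lemma dom_empty [simp]: "dom empty = empty"
  by (rule dom_func[OF func_empty])

lemma in_conditions: "cond p \<longleftrightarrow> p \<epsilon> fin_seqs \<kappa> \<or> p = z"
  by (simp add: conditions_def)

lemma empty_fin_seq: "empty \<epsilon> fin_seqs \<kappa>"
  using in_fin_seqs func_empty empty_in_omega by blast

lemma empty_cond [simp]: "cond empty" "empty \<noteq> z" "z \<noteq> empty"
  using empty_fin_seq z by (auto simp: in_conditions)

lemma cmult_cond [simp]: "cond p \<Longrightarrow> cond q \<Longrightarrow> cond (cmult z p q)"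
  by (auto simp: cmult_def in_conditions)

lemma cmult_empty_left [simp]: "cmult z empty p = p"
  by (auto simp: cmult_def subset_of_def)

lemma cmult_empty_right [simp]: "cmult z p empty = p"
  by (auto simp: cmult_def subset_of_def intro: extensionality)

lemma dom_mono:
  assumes "p \<epsilon> fin_seqs \<kappa>" "q \<epsilon> fin_seqs \<kappa>" "subset_of p q"
  shows "subset_of (dom p) (dom q)"
proof -
  obtain n k where n: "func p n \<kappa>" and k: "func q k \<kappa>" using assms by (auto simp: in_fin_seqs)
  have "x \<epsilon> k" if "x \<epsilon> n" for x
    using func_pair[OF n that] func_value[OF k] assms(3) by (auto simp: subset_of_def)
  then show ?thesis using n k by (simp add: dom_func subset_of_def)
qed

text \<open>A product other than \<open>z\<close> is the longer factor and includes both, so an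
  integer that bounds its length bounds both lengths.\<close>

lemma cmult_bounded:
  assumes "cond p" "cond q" "cmult z p q \<noteq> z" "subset_of (dom (cmult z p q)) n"
  shows "p \<noteq> z" "q \<noteq> z" "subset_of (dom p) n" "subset_of (dom q) n"
proof -
  show ne: "p \<noteq> z" "q \<noteq> z" using assms(3) by (auto simp: cmult_def)
  then have "subset_of (dom p) (dom (cmult z p q)) \<and> subset_of (dom q) (dom (cmult z p q))"
    using assms(1-3) dom_mono[of p q] dom_mono[of q p]
    by (auto simp: cmult_def in_conditions subset_of_def split: if_splits)
  then show "subset_of (dom p) n" "subset_of (dom q) n"
    using assms(4) by (auto simp: subset_of_def)
qed

lemma dfun_cmult: "dfun t \<Longrightarrow> dfun u \<Longrightarrow> dfun (\<lambda>e. cmult z (t e) (u e))"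
  unfolding cmult_def by (intro definable_set_intros)

text \<open>Application, push and process formation of the extended algebra share this shape.
  \<open>G\<close> uses \<open>g\<close> to match the definition literally; \<open>h\<close> is a
  definable function that agrees with \<open>g\<close> where it matters, and it makes
  \<open>G\<close> a set of the model.\<close>

lemma product_operation:
  fixes g :: "'m \<Rightarrow> 'm \<Rightarrow> 'm" and X Y Z :: 'm
  defines "G \<equiv> set_of (\<lambda>w. \<exists>x p y q. x \<epsilon> X \<and> cond p \<and> y \<epsilon> Y \<and> cond q \<and>
    w = opair (opair (opair x p) (opair y q)) (opair (g x y) (cmult z p q)))"
  assumes g: "\<And>x y. x \<epsilon> X \<Longrightarrow> y \<epsilon> Y \<Longrightarrow> g x y \<epsilon> Z"
    and h: "dfun (\<lambda>e. h (e 0) (e (Suc 0)))" "\<And>x y. x \<epsilon> X \<Longrightarrow> y \<epsilon> Y \<Longrightarrow> h x y = g x y"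
  shows "func G (cprod (cprod X P) (cprod Y P)) (cprod Z P)"
    and "x \<epsilon> X \<Longrightarrow> cond p \<Longrightarrow> y \<epsilon> Y \<Longrightarrow> cond q \<Longrightarrow>
      fapply G (opair (opair x p) (opair y q)) = opair (g x y) (cmult z p q)"
proof -
  let ?Q = "\<lambda>w. \<exists>x p y q. x \<epsilon> X \<and> cond p \<and> y \<epsilon> Y \<and> cond q \<and>
    w = opair (opair (opair x p) (opair y q)) (opair (h x y) (cmult z p q))"
  have "G = set_of ?Q"
    unfolding G_def by (rule arg_cong[of _ _ set_of]) (use h(2) in \<open>auto simp: fun_eq_iff\<close>)
  moreover have "w \<epsilon> set_of ?Q \<longleftrightarrow> ?Q w" for w
  proof (rule in_set_of_bounded)
    show "definable (\<lambda>e. ?Q (e 0))"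
      by (intro definable_set_intros dfun_cmult dfun_binary[OF h(1)])
    show "w \<epsilon> cprod (cprod (cprod X P) (cprod Y P)) (cprod Z P)" if "?Q w" for w
      using that g h(2) by auto
  qed
  ultimately have G: "w \<epsilon> G \<longleftrightarrow> (\<exists>x p y q. x \<epsilon> X \<and> cond p \<and> y \<epsilon> Y \<and> cond q \<and>
      w = opair (opair (opair x p) (opair y q)) (opair (g x y) (cmult z p q)))" for w
    using h(2) by auto
  show func: "func G (cprod (cprod X P) (cprod Y P)) (cprod Z P)"
    unfolding func_def using g by (auto simp: G in_cprod)
  show "fapply G (opair (opair x p) (opair y q)) = opair (g x y) (cmult z p q)"
    if "x \<epsilon> X" "cond p" "y \<epsilon> Y" "cond q"
    using func_value[OF func, of "opair (opair x p) (opair y q)"] that by (auto simp: G)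
qed

section \<open>Operations, pole and integers of the extended algebra\<close>

lemma ext_simps [simp]:
  "Terms B = cprod (Terms A) P" "Stacks B = cprod (Stacks A) P" "pole B = b"
  "iB B = opair B_ext empty" "iI B = opair I_ext empty"
  "iK B = opair K_ext empty" "iW B = opair W_ext empty"
  by (simp_all add: extended_algebra_def)

lemma app_ext:
  "func (app_fun B) (cprod (Terms B) (Terms B)) (Terms B)"
  "trm \<xi> \<Longrightarrow> cond p \<Longrightarrow> trm \<eta> \<Longrightarrow> cond q \<Longrightarrow>
    app B (opair \<xi> p) (opair \<eta> q) = opair (iC A \<bullet> \<xi> \<bullet> \<eta>) (cmult z p q)"
proof -
  let ?h = "\<lambda>x y. value_at (app_fun A) (opair (value_at (app_fun A) (opair (iC A) x)) y)"
  have h: "dfun (\<lambda>e. ?h (e 0) (e (Suc 0)))"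
    by (intro definable_set_intros dfun_value_at)
  note op = product_operation[of "Terms A" "Terms A" "\<lambda>\<xi> \<eta>. iC A \<bullet> \<xi> \<bullet> \<eta>" "Terms A" ?h,
      OF _ h, simplified app_value_at]
  show "func (app_fun B) (cprod (Terms B) (Terms B)) (Terms B)"
    using op(1) by (simp add: extended_algebra_def app_value_at)
  show "app B (opair \<xi> p) (opair \<eta> q) = opair (iC A \<bullet> \<xi> \<bullet> \<eta>) (cmult z p q)"
    if "trm \<xi>" "cond p" "trm \<eta>" "cond q"
    unfolding app_def[of B]
    using op(2) that by (simp add: extended_algebra_def app_value_at)
qed

lemma push_ext:
  "func (push_fun B) (cprod (Terms B) (Stacks B)) (Stacks B)"
  "trm \<xi> \<Longrightarrow> cond p \<Longrightarrow> stk \<pi> \<Longrightarrow> cond q \<Longrightarrow>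
    push B (opair \<xi> p) (opair \<pi> q) = opair (\<xi> \<triangleright> \<pi>) (cmult z p q)"
proof -
  let ?h = "\<lambda>x y. value_at (push_fun A) (opair x y)"
  have h: "dfun (\<lambda>e. ?h (e 0) (e (Suc 0)))"
    by (intro definable_set_intros dfun_value_at)
  note op = product_operation[of "Terms A" "Stacks A" "\<lambda>\<xi> \<pi>. \<xi> \<triangleright> \<pi>" "Stacks A" ?h, OF _ h]
  show "func (push_fun B) (cprod (Terms B) (Stacks B)) (Stacks B)"
    using op(1) by (simp add: extended_algebra_def push_value_at)
  show "push B (opair \<xi> p) (opair \<pi> q) = opair (\<xi> \<triangleright> \<pi>) (cmult z p q)"
    if "trm \<xi>" "cond p" "stk \<pi>" "cond q"
    unfolding push_def[of B]
    using op(2) that by (simp add: extended_algebra_def push_value_at)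
qed

lemma process_ext:
  "trm \<xi> \<Longrightarrow> cond p \<Longrightarrow> stk \<pi> \<Longrightarrow> cond q \<Longrightarrow>
    process B (opair \<xi> p) (opair \<pi> q) = opair (process A \<xi> \<pi>) (cmult z p q)"
proof -
  let ?h = "\<lambda>x y. value_at (process_fun A) (opair x y)"
  have h: "dfun (\<lambda>e. ?h (e 0) (e (Suc 0)))"
    by (intro definable_set_intros dfun_value_at)
  note op = product_operation[of "Terms A" "Stacks A" "process A" "Processes A" ?h, OF _ h]
  show "process B (opair \<xi> p) (opair \<pi> q) = opair (process A \<xi> \<pi>) (cmult z p q)"
    if "trm \<xi>" "cond p" "stk \<pi>" "cond q"
    unfolding process_def[of B] using op(2) that
    by (simp add: extended_algebra_def process_value_at process_closed)
qed

lemma in_QP_ext: "w \<epsilon> QP B \<longleftrightarrow> (\<exists>\<theta>. prf \<theta> \<and> w = opair \<theta> empty)"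
proof -
  have "definable (\<lambda>e. \<exists>\<theta>. prf \<theta> \<and> e 0 = opair \<theta> empty)" by (intro definable_set_intros)
  then have "w \<epsilon> set_of (\<lambda>w. \<exists>\<theta>. prf \<theta> \<and> w = opair \<theta> empty) \<longleftrightarrow>
      (\<exists>\<theta>. prf \<theta> \<and> w = opair \<theta> empty)"
    by (rule in_set_of_bounded[of _ "cprod (QP A) (upair empty empty)"]) auto
  then show ?thesis by (simp add: extended_algebra_def)
qed

text \<open>This is where integers enter the stacks of \<open>A\<close>. If the product is
  \<open>z\<close>, nothing is tested.\<close>

lemma process_ext_in_pole:
  assumes "trm \<xi>" "cond p" "stk \<pi>" "cond q"
  shows "process B (opair \<xi> p) (opair \<pi> q) \<epsilon> b \<longleftrightarrow>
    (\<forall>n. n \<epsilon> omega \<and> cmult z p q \<noteq> z \<and> subset_of (dom (cmult z p q)) n \<longrightarrow>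
      \<xi> \<star> numeral_of A n \<triangleright> \<pi>)"
  using pole assms unfolding extended_pole_def by (simp add: process_ext)

lemma instructions_ext: "iB B \<epsilon> Terms B" "iI B \<epsilon> Terms B" "iK B \<epsilon> Terms B" "iW B \<epsilon> Terms B"
  by simp_all

lemmas ext_numerals_spec = numerals_spec[OF app_ext(1) instructions_ext]
lemmas ext_falsity_stacks = falsity_stacks[OF app_ext(1) instructions_ext push_ext(1)]

lemma sigma_B: "sigma B = opair sigma_ext empty"
  unfolding sigma_def sigma_ext_def by (simp add: app_ext(2))

text \<open>All instructions involved carry the condition \<open>empty\<close>, which is neutral for
  \<open>cmult\<close>, so only the first component evolves.\<close>

lemma numeral_of_B:
  assumes "n \<epsilon> omega"
  shows "numeral_of B n = opair (fapply ext_numerals n) empty"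
proof -
  have value_at_numerals: "value_at (numerals B) k = numeral_of B k"
    "value_at ext_numerals k = fapply ext_numerals k" if "k \<epsilon> omega" for k
    using that ext_numerals_spec ext_numerals(1) by (auto simp: numeral_of_def)
  have "definable (\<lambda>e. value_at (numerals B) (e 0) = opair (value_at ext_numerals (e 0)) empty)"
    by (intro definable_set_intros dfun_value_at)
  then have "value_at (numerals B) n = opair (value_at ext_numerals n) empty" using assms
  proof (induction n rule: omega_induct)
    case empty
    show ?case
      using numeral_of_empty[OF app_ext(1) instructions_ext]
      by (simp add: value_at_numerals ext_numerals(2) app_ext(2))
  next
    case (succ n)
    then show ?case
      using numeral_of_succ[OF app_ext(1) instructions_ext, of n]
      by (simp add: value_at_numerals ext_numerals(3) sigma_B app_ext(2))
  qed
  then show ?thesis by (simp add: value_at_numerals assms)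
qed

section \<open>Elementary formulas\<close>

lemma realizes_AI:
  "trm \<xi> \<Longrightarrow> (\<And>\<pi>. \<pi> \<in> falsity A e F \<Longrightarrow> stk \<pi> \<Longrightarrow> \<xi> \<star> \<pi>) \<Longrightarrow> realizes A e \<xi> F"
  using falsity_stacks[OF operations_func(1) trm_instructions(1,3,4,5) operations_func(2)]
  by (auto simp: realizes_def orthogonal_def)

lemma realizes_AD: "realizes A e \<xi> F \<Longrightarrow> trm \<xi> \<and> (\<pi> \<in> falsity A e F \<longrightarrow> \<xi> \<star> \<pi>)"
  by (auto simp: realizes_def orthogonal_def)

text \<open>With \<open>realizes_BD\<close>, this reduces realizability in the extended algebra to
  processes of \<open>A\<close> with an admissible integer on top.\<close>

lemma realizes_BI:
  assumes "trm \<xi>" "cond p"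
    and "\<And>\<pi> q n. opair \<pi> q \<in> falsity B e F \<Longrightarrow> stk \<pi> \<Longrightarrow> cond q \<Longrightarrow> n \<epsilon> omega \<Longrightarrow>
      cmult z p q \<noteq> z \<Longrightarrow> subset_of (dom (cmult z p q)) n \<Longrightarrow> \<xi> \<star> numeral_of A n \<triangleright> \<pi>"
  shows "realizes B e (opair \<xi> p) F"
proof -
  have "process B (opair \<xi> p) \<rho> \<epsilon> b" if "\<rho> \<in> falsity B e F" for \<rho>
  proof -
    have "\<rho> \<epsilon> cprod (Stacks A) P" using ext_falsity_stacks[OF that] by simp
    then obtain \<pi> q where "\<rho> = opair \<pi> q" "stk \<pi>" "cond q" by (auto simp: in_cprod)
    then show ?thesis using assms that by (simp add: process_ext_in_pole)
  qed
  then show ?thesis using assms(1,2) by (auto simp: realizes_def orthogonal_def)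
qed

lemma realizes_BD:
  assumes "realizes B e (opair \<xi> p) F"
  shows "trm \<xi>" "cond p"
    and "opair \<pi> q \<in> falsity B e F \<Longrightarrow> n \<epsilon> omega \<Longrightarrow> cmult z p q \<noteq> z \<Longrightarrow>
      subset_of (dom (cmult z p q)) n \<Longrightarrow> \<xi> \<star> numeral_of A n \<triangleright> \<pi>"
proof -
  show \<xi>: "trm \<xi>" "cond p" using assms by (simp_all add: realizes_def orthogonal_def)
  show "\<xi> \<star> numeral_of A n \<triangleright> \<pi>" if "opair \<pi> q \<in> falsity B e F" "n \<epsilon> omega"
    "cmult z p q \<noteq> z" "subset_of (dom (cmult z p q)) n"
  proof -
    have "stk \<pi>" "cond q" using ext_falsity_stacks[OF that(1)] by simp_all
    moreover have "process B (opair \<xi> p) (opair \<pi> q) \<epsilon> b"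
      using assms that(1) by (simp add: realizes_def orthogonal_def)
    ultimately show ?thesis using that \<xi> by (simp add: process_ext_in_pole)
  qed
qed

lemma falsity_B_pair:
  assumes "\<rho> \<in> falsity B e F"
  obtains \<pi> q where "\<rho> = opair \<pi> q" "stk \<pi>" "cond q"
  using ext_falsity_stacks[OF assms] by (auto simp: in_cprod)

text \<open>\<open>\<theta>\<close> and \<open>\<theta>'\<close> are chosen before the assignment,
  the realizer and the condition. This uniformity lets them pass through both quantifiers.\<close>

definition transfers :: "'m elementary \<Rightarrow> 'm \<Rightarrow> 'm \<Rightarrow> bool" where
  "transfers F \<theta> \<theta>' \<longleftrightarrow> prf \<theta> \<and> prf \<theta>' \<and>
    (\<forall>e \<tau> p. cond p \<longrightarrow> realizes A e \<tau> F \<longrightarrow> realizes B e (opair (\<theta> \<bullet> \<tau>) p) F) \<and>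
    (\<forall>e \<tau> p m. p \<noteq> z \<longrightarrow> m \<epsilon> omega \<longrightarrow> subset_of (dom p) m \<longrightarrow>
      realizes B e (opair \<tau> p) F \<longrightarrow> realizes A e (\<theta>' \<bullet> numeral_of A m \<bullet> \<tau>) F)"

lemma transfersD:
  assumes "transfers F \<theta> \<theta>'"
  shows "prf \<theta>" "prf \<theta>'"
    and "cond p \<Longrightarrow> realizes A e \<tau> F \<Longrightarrow> realizes B e (opair (\<theta> \<bullet> \<tau>) p) F"
    and "realizes B e (opair \<tau> p) F \<Longrightarrow> p \<noteq> z \<Longrightarrow> m \<epsilon> omega \<Longrightarrow> subset_of (dom p) m \<Longrightarrow>
      realizes A e (\<theta>' \<bullet> numeral_of A m \<bullet> \<tau>) F"
  using assms unfolding transfers_def by blast+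

text \<open>The falsity value is empty, so any proof-like term would serve.\<close>

lemma transfers_Top: "transfers Top (iK A) (iK A)"
  unfolding transfers_def using realizes_AD realizes_BD
  by (auto intro!: realizes_AI realizes_BI)

text \<open>\<open>K \<tau>\<close> discards the integer that the extended algebra puts on top;
  \<open>C I m \<tau>\<close> supplies the integer that \<open>\<tau>\<close> expects.\<close>

lemma transfers_Bot: "transfers Bot (iK A) (iC A \<bullet> iI A)"
  unfolding transfers_def
proof (intro conjI allI impI)
  fix e \<tau> p assume "cond p" "realizes A e \<tau> Bot"
  then show "realizes B e (opair (iK A \<bullet> \<tau>) p) Bot"
    using realizes_AD[of e \<tau> Bot] by (intro realizes_BI pole_app pole_K) simp_all
next
  fix e \<tau> p m
  assume *: "p \<noteq> z" "m \<epsilon> omega" "subset_of (dom p) m" "realizes B e (opair \<tau> p) Bot"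
  have \<tau>: "trm \<tau>" "cond p" using realizes_BD[OF *(4)] by simp_all
  show "realizes A e (iC A \<bullet> iI A \<bullet> numeral_of A m \<bullet> \<tau>) Bot"
  proof (rule realizes_AI)
    fix \<pi> assume "stk \<pi>"
    then have "\<tau> \<star> numeral_of A m \<triangleright> \<pi>"
      using realizes_BD(3)[OF *(4), of \<pi> empty m] * by simp
    then show "iC A \<bullet> iI A \<bullet> numeral_of A m \<bullet> \<tau> \<star> \<pi>"
      by (intro pole_intros trm_app stk_push trm_instructions trm_numeral \<tau> *(2) \<open>stk \<pi>\<close>)
  qed (use \<tau> *(2) in simp)
qed simp_all

text \<open>The equation is decided in the ground model, hence in the same way for both algebras:
  the falsity value is that of \<open>F\<close> or empty.\<close>

lemma transfers_EqImp:
  assumes "transfers F \<theta> \<theta>'"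
  shows "transfers (EqImp t u F) \<theta> \<theta>'"
  unfolding transfers_def
proof (intro conjI allI impI)
  show "prf \<theta>" "prf \<theta>'" using transfersD[OF assms] by blast+
  fix e \<tau> p assume "cond p" "realizes A e \<tau> (EqImp t u F)"
  then show "realizes B e (opair (\<theta> \<bullet> \<tau>) p) (EqImp t u F)"
    using transfersD(3)[OF assms, of p e \<tau>] \<open>prf \<theta>\<close>
    by (cases "fterm_val e t = fterm_val e u")
      (simp_all add: realizes_def orthogonal_def prf_trm)
next
  fix e \<tau> p m
  assume "p \<noteq> z" "m \<epsilon> omega" "subset_of (dom p) m" "realizes B e (opair \<tau> p) (EqImp t u F)"
  then show "realizes A e (\<theta>' \<bullet> numeral_of A m \<bullet> \<tau>) (EqImp t u F)"
    using transfersD(4)[OF assms, of e \<tau> p m] prf_trm[OF transfersD(2)[OF assms]]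
    by (cases "fterm_val e t = fterm_val e u") (simp_all add: realizes_def orthogonal_def)
qed

lemma realizes_Univ: "realizes C e \<xi> (Univ x F) \<longleftrightarrow> (\<forall>a. realizes C (e(x := a)) \<xi> F)"
  by (auto simp: realizes_def orthogonal_def)

lemma transfers_Univ: "transfers F \<theta> \<theta>' \<Longrightarrow> transfers (Univ x F) \<theta> \<theta>'"
  unfolding transfers_def realizes_Univ by blast

text \<open>In lambda notation, \<open>\<theta> = \<lambda>\<tau> n \<xi>. \<theta>G (\<tau>
  (\<theta>F' n \<xi>)) n\<close> and \<open>\<theta>' = \<lambda>n \<tau> \<xi>. \<theta>G' n (C
  \<tau> (\<theta>F \<xi>))\<close>.\<close>

lemma transfers_Imp:
  assumes F: "transfers F \<theta>F \<theta>F'" and G: "transfers G \<theta>G \<theta>G'"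
  shows "\<exists>\<theta> \<theta>'. transfers (Imp F G) \<theta> \<theta>'"
proof -
  note prfs = transfersD(1,2)[OF F] transfersD(1,2)[OF G]
  note trms = prfs[THEN prf_trm]
  \<comment> \<open>The leading \<open>CI\<close> in \<open>t\<close> stops the unwinding, so that
    the premise speaks of the compound term as a whole. Its membership in the pole is what
    realizability yields; passing from there to its unwound form would be a forward step.\<close>
  obtain \<theta> where \<theta>: "prf \<theta>" "\<And>\<tau> n \<xi> \<pi>. trm \<tau> \<Longrightarrow> trm n \<Longrightarrow> trm \<xi> \<Longrightarrow> stk \<pi> \<Longrightarrow>
      \<theta>G \<bullet> (\<tau> \<bullet> (\<theta>F' \<bullet> n \<bullet> \<xi>)) \<star> n \<triangleright> \<pi> \<Longrightarrow> \<theta> \<star> \<tau> \<triangleright> n \<triangleright> \<xi> \<triangleright> \<pi>"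
    by (rule combinator3[of \<theta>G \<theta>F' \<theta>F',
          where t = "CI \<cdot> (CVar 3 \<cdot> (CVar 0 \<cdot> (CVar 4 \<cdot> CVar 1 \<cdot> CVar 2))) \<cdot> CVar 1"])
      (use prfs trms in \<open>simp_all add: pole_I\<close>)
  obtain \<theta>' where \<theta>': "prf \<theta>'" "\<And>n \<tau> \<xi> \<pi>. trm n \<Longrightarrow> trm \<tau> \<Longrightarrow> trm \<xi> \<Longrightarrow> stk \<pi> \<Longrightarrow>
      \<theta>G' \<bullet> n \<bullet> (iC A \<bullet> \<tau> \<bullet> (\<theta>F \<bullet> \<xi>)) \<star> \<pi> \<Longrightarrow> \<theta>' \<star> n \<triangleright> \<tau> \<triangleright> \<xi> \<triangleright> \<pi>"
    by (rule combinator3[of \<theta>G' \<theta>F \<theta>F,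
          where t = "CI \<cdot> (CVar 3 \<cdot> CVar 0 \<cdot> (CC \<cdot> CVar 1 \<cdot> (CVar 4 \<cdot> CVar 2)))"])
      (use prfs trms in \<open>simp_all add: pole_I\<close>)
  note [simp] = \<theta>(1)[THEN prf_trm] \<theta>'(1)[THEN prf_trm] trms
  have "transfers (Imp F G) \<theta> \<theta>'"
    unfolding transfers_def
  proof (intro conjI allI impI \<theta>(1) \<theta>'(1))
    fix e \<tau> p assume p: "cond p" and \<tau>: "realizes A e \<tau> (Imp F G)"
    have [simp]: "trm \<tau>" using realizes_AD[OF \<tau>] by blast
    show "realizes B e (opair (\<theta> \<bullet> \<tau>) p) (Imp F G)"
    proof (rule realizes_BI)
      fix \<rho> r n
      assume "opair \<rho> r \<in> falsity B e (Imp F G)" and n: "n \<epsilon> omega" and "cond r"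
        and pr: "cmult z p r \<noteq> z" "subset_of (dom (cmult z p r)) n"
      then obtain w \<pi>' where w: "opair \<rho> r = push B w \<pi>'" "w \<in> orthogonal B (falsity B e F)"
        and \<pi>': "\<pi>' \<in> falsity B e G" by auto
      obtain \<pi> q where \<pi>: "\<pi>' = opair \<pi> q" "stk \<pi>" "cond q" using falsity_B_pair[OF \<pi>'] .
      have "w \<epsilon> Terms B" using w(2) unfolding orthogonal_def by blast
      then obtain \<xi> s where \<xi>: "w = opair \<xi> s" "trm \<xi>" "cond s" by (auto simp: in_cprod)
      have \<rho>: "\<rho> = \<xi> \<triangleright> \<pi>" "r = cmult z s q" using w(1) \<pi> \<xi> by (simp_all add: push_ext(2))
      \<comment> \<open>The integer \<open>n\<close> bounds the product of \<open>p\<close> and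
        \<open>r\<close>, hence \<open>r\<close>, and therefore also the factors \<open>s\<close>
        and \<open>q\<close> of \<open>r\<close>; \<open>\<theta>F'\<close> needs the bound on
        \<open>s\<close>.\<close>
      note r = cmult_bounded[OF p \<open>cond r\<close> pr]
      note sq = cmult_bounded[OF \<xi>(3) \<pi>(3), of n, folded \<rho>(2), OF r(2,4)]
      have "realizes A e (\<theta>F' \<bullet> numeral_of A n \<bullet> \<xi>) F"
        using transfersD(4)[OF F _ sq(1) n sq(3)] w(2) \<xi>(1) by (simp add: realizes_def)
      then have "realizes A e (\<tau> \<bullet> (\<theta>F' \<bullet> numeral_of A n \<bullet> \<xi>)) G"
        using realizes_AD[OF \<tau>] n \<xi>(2)
        by (intro realizes_AI pole_app) (auto simp: realizes_def)
      \<comment> \<open>The condition \<open>empty\<close> is enough here: its product with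
        \<open>q\<close> is \<open>q\<close>, which \<open>n\<close> bounds.\<close>
      from realizes_BD(3)[OF transfersD(3)[OF G empty_cond(1) this] _ n, of \<pi> q]
      have "\<theta>G \<bullet> (\<tau> \<bullet> (\<theta>F' \<bullet> numeral_of A n \<bullet> \<xi>)) \<star> numeral_of A n \<triangleright> \<pi>"
        using \<pi>' \<pi>(1) sq by simp
      then show "\<theta> \<bullet> \<tau> \<star> numeral_of A n \<triangleright> \<rho>"
        unfolding \<rho>(1) by - (rule pole_app, rule \<theta>(2), (use n \<xi>(2) \<pi>(2) in simp_all))
    qed (use p in simp_all)
  next
    fix e \<tau> p m
    assume p: "p \<noteq> z" and m: "m \<epsilon> omega" and pm: "subset_of (dom p) m"
      and \<tau>: "realizes B e (opair \<tau> p) (Imp F G)"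
    note [simp] = realizes_BD(1,2)[OF \<tau>]
    show "realizes A e (\<theta>' \<bullet> numeral_of A m \<bullet> \<tau>) (Imp F G)"
    proof (rule realizes_AI)
      fix \<rho> assume "\<rho> \<in> falsity A e (Imp F G)"
      then obtain \<xi> \<pi> where \<rho>: "\<rho> = \<xi> \<triangleright> \<pi>" and \<xi>: "realizes A e \<xi> F"
        and \<pi>: "\<pi> \<in> falsity A e G" by (auto simp: realizes_def)
      have [simp]: "trm \<xi>" using realizes_AD[OF \<xi>] by blast
      have [simp]: "stk \<pi>"
        using falsity_stacks[OF operations_func(1) trm_instructions(1,3,4,5) operations_func(2) \<pi>] .
      \<comment> \<open>The argument is transferred at the condition \<open>empty\<close>, so the
        result keeps the condition \<open>p\<close> of \<open>\<tau>\<close> and the bound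
        \<open>m\<close> remains valid.\<close>
      have "realizes B e (opair (iC A \<bullet> \<tau> \<bullet> (\<theta>F \<bullet> \<xi>)) p) G"
      proof (rule realizes_BI)
        fix \<pi> q n
        assume \<pi>: "opair \<pi> q \<in> falsity B e G" "stk \<pi>" "cond q" and n: "n \<epsilon> omega"
          and pq: "cmult z p q \<noteq> z" "subset_of (dom (cmult z p q)) n"
        have "push B (opair (\<theta>F \<bullet> \<xi>) empty) (opair \<pi> q) \<in> falsity B e (Imp F G)"
          using transfersD(3)[OF F empty_cond(1) \<xi>] \<pi>(1) by (auto simp: realizes_def)
        then have "opair ((\<theta>F \<bullet> \<xi>) \<triangleright> \<pi>) q \<in> falsity B e (Imp F G)"
          using \<pi>(2,3) by (simp add: push_ext(2))
        then have "\<tau> \<star> numeral_of A n \<triangleright> (\<theta>F \<bullet> \<xi>) \<triangleright> \<pi>"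
          using realizes_BD(3)[OF \<tau> _ n pq] by blast
        then show "iC A \<bullet> \<tau> \<bullet> (\<theta>F \<bullet> \<xi>) \<star> numeral_of A n \<triangleright> \<pi>"
          using n \<pi>(2) by (intro pole_app pole_C) simp_all
      qed simp_all
      from realizes_AD[OF transfersD(4)[OF G this p m pm]]
      have "\<theta>G' \<bullet> numeral_of A m \<bullet> (iC A \<bullet> \<tau> \<bullet> (\<theta>F \<bullet> \<xi>)) \<star> \<pi>" using \<pi> by blast
      then show "\<theta>' \<bullet> numeral_of A m \<bullet> \<tau> \<star> \<rho>"
        unfolding \<rho> by - (rule pole_app, rule pole_app, rule \<theta>'(2), (use m in simp_all))
    qed (use m in simp)
  qed
  then show ?thesis by blast
qed

text \<open>A realizer is promised to work only on the literal integers of its own algebra. A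
  foreign integer is therefore run as an iterator that rebuilds the native term before the realizer
  is called.\<close>

lemma transfers_ForallInt:
  assumes F: "transfers F \<theta>F \<theta>F'"
  shows "\<exists>\<theta> \<theta>'. transfers (ForallInt x F) \<theta> \<theta>'"
proof -
  note prfs = transfersD(1,2)[OF F]
  note trms = prfs[THEN prf_trm]
  have prf_zero: "prf (numeral_of A empty)" by (simp add: A_numeral_empty)
  have prf_zero_ext: "prf (fapply ext_numerals empty)" by (simp add: ext_numerals(2))
  \<comment> \<open>\<open>\<phi>\<close> is the successor step on stored integers of
    \<open>A\<close>, \<open>\<gamma>\<close> the final continuation, and \<open>\<theta>\<close>
    runs the extended integer \<open>\<nu>\<close> on both, starting from the stored value
    zero.\<close>
  obtain \<phi> where \<phi>: "prf \<phi>" "\<And>\<mu> \<gamma> \<xi> \<pi>. trm \<mu> \<Longrightarrow> trm \<gamma> \<Longrightarrow> trm \<xi> \<Longrightarrow> stk \<pi> \<Longrightarrow>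
      \<gamma> \<star> \<mu> \<triangleright> (sigma A \<bullet> \<xi>) \<triangleright> \<pi> \<Longrightarrow> \<phi> \<star> \<mu> \<triangleright> \<gamma> \<triangleright> \<xi> \<triangleright> \<pi>"
    by (rule combinator3[of "sigma A" "sigma A" "sigma A",
          where t = "CVar 1 \<cdot> CVar 0 \<cdot> (CVar 3 \<cdot> CVar 2)"]) simp_all
  obtain \<gamma> where \<gamma>: "prf \<gamma>" "\<And>\<tau> \<mu> \<xi> \<pi>. trm \<tau> \<Longrightarrow> trm \<mu> \<Longrightarrow> trm \<xi> \<Longrightarrow> stk \<pi> \<Longrightarrow>
      \<theta>F \<bullet> (\<tau> \<bullet> \<xi>) \<star> \<mu> \<triangleright> \<pi> \<Longrightarrow> \<gamma> \<star> \<tau> \<triangleright> \<mu> \<triangleright> \<xi> \<triangleright> \<pi>"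
    by (rule combinator3[of \<theta>F \<theta>F \<theta>F,
          where t = "CI \<cdot> (CVar 3 \<cdot> (CVar 0 \<cdot> CVar 2)) \<cdot> CVar 1"])
      (use prfs trms in \<open>simp_all add: pole_I\<close>)
  obtain \<theta> where \<theta>: "prf \<theta>" "\<And>\<tau> \<mu> \<nu> \<pi>. trm \<tau> \<Longrightarrow> trm \<mu> \<Longrightarrow> trm \<nu> \<Longrightarrow> stk \<pi> \<Longrightarrow>
      \<nu> \<star> \<mu> \<triangleright> \<phi> \<triangleright> (\<gamma> \<bullet> \<tau>) \<triangleright> numeral_of A empty \<triangleright> \<pi> \<Longrightarrow> \<theta> \<star> \<tau> \<triangleright> \<mu> \<triangleright> \<nu> \<triangleright> \<pi>"
    by (rule combinator3[of \<phi> \<gamma> "numeral_of A empty",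
          where t = "CVar 2 \<cdot> CVar 1 \<cdot> CVar 3 \<cdot> (CVar 4 \<cdot> CVar 0) \<cdot> CVar 5"])
      (use \<phi>(1) \<gamma>(1) prf_zero in simp_all)
  \<comment> \<open>The same three ingredients for the opposite conversion. The bound
    \<open>\<mu>\<close> is now an argument of the final continuation, as integers of
    \<open>A\<close> do not pass it along.\<close>
  obtain \<phi>' where \<phi>': "prf \<phi>'" "\<And>\<gamma> \<xi> \<pi>. trm \<gamma> \<Longrightarrow> trm \<xi> \<Longrightarrow> stk \<pi> \<Longrightarrow>
      \<gamma> \<star> (iC A \<bullet> sigma_ext \<bullet> \<xi>) \<triangleright> \<pi> \<Longrightarrow> \<phi>' \<star> \<gamma> \<triangleright> \<xi> \<triangleright> \<pi>"
    by (rule combinator2[of "iC A \<bullet> sigma_ext" "iI A" "iI A",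
          where t = "CVar 0 \<cdot> (CVar 3 \<cdot> CVar 1)"]) simp_all
  obtain \<gamma>' where \<gamma>': "prf \<gamma>'" "\<And>\<mu> \<tau> \<xi> \<pi>. trm \<mu> \<Longrightarrow> trm \<tau> \<Longrightarrow> trm \<xi> \<Longrightarrow> stk \<pi> \<Longrightarrow>
      \<theta>F' \<bullet> \<mu> \<bullet> (iC A \<bullet> \<tau> \<bullet> \<xi>) \<star> \<pi> \<Longrightarrow> \<gamma>' \<star> \<mu> \<triangleright> \<tau> \<triangleright> \<xi> \<triangleright> \<pi>"
    by (rule combinator3[of \<theta>F' \<theta>F' \<theta>F',
          where t = "CI \<cdot> (CVar 3 \<cdot> CVar 0 \<cdot> (CC \<cdot> CVar 1 \<cdot> CVar 2))"])
      (use prfs trms in \<open>simp_all add: pole_I\<close>)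
  obtain \<theta>' where \<theta>': "prf \<theta>'" "\<And>\<mu> \<tau> \<nu> \<pi>. trm \<mu> \<Longrightarrow> trm \<tau> \<Longrightarrow> trm \<nu> \<Longrightarrow> stk \<pi> \<Longrightarrow>
      \<nu> \<star> \<phi>' \<triangleright> (\<gamma>' \<bullet> \<mu> \<bullet> \<tau>) \<triangleright> fapply ext_numerals empty \<triangleright> \<pi> \<Longrightarrow> \<theta>' \<star> \<mu> \<triangleright> \<tau> \<triangleright> \<nu> \<triangleright> \<pi>"
    by (rule combinator3[of \<phi>' \<gamma>' "fapply ext_numerals empty",
          where t = "CVar 2 \<cdot> CVar 3 \<cdot> (CVar 4 \<cdot> CVar 0 \<cdot> CVar 1) \<cdot> CVar 5"])
      (use \<phi>'(1) \<gamma>'(1) prf_zero_ext in simp_all)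
  note [simp] = trms \<phi>(1)[THEN prf_trm] \<gamma>(1)[THEN prf_trm] \<theta>(1)[THEN prf_trm]
    \<phi>'(1)[THEN prf_trm] \<gamma>'(1)[THEN prf_trm] \<theta>'(1)[THEN prf_trm]
  have "transfers (ForallInt x F) \<theta> \<theta>'"
    unfolding transfers_def
  proof (intro conjI allI impI \<theta>(1) \<theta>'(1))
    fix e \<tau> p assume p: "cond p" and \<tau>: "realizes A e \<tau> (ForallInt x F)"
    have [simp]: "trm \<tau>" using realizes_AD[OF \<tau>] by blast
    show "realizes B e (opair (\<theta> \<bullet> \<tau>) p) (ForallInt x F)"
    proof (rule realizes_BI)
      fix \<rho> r m
      assume "opair \<rho> r \<in> falsity B e (ForallInt x F)" and m: "m \<epsilon> omega" and "cond r"
        and pr: "cmult z p r \<noteq> z" "subset_of (dom (cmult z p r)) m"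
      then obtain n \<pi>' where n: "opair \<rho> r = push B (numeral_of B n) \<pi>'" "n \<epsilon> omega"
        and \<pi>': "\<pi>' \<in> falsity B (e(x := n)) F" by auto
      obtain \<pi> q where \<pi>: "\<pi>' = opair \<pi> q" "stk \<pi>" "cond q" using falsity_B_pair[OF \<pi>'] .
      have \<rho>: "\<rho> = fapply ext_numerals n \<triangleright> \<pi>" "r = q"
        using n \<pi> by (simp_all add: push_ext(2) numeral_of_B)
      note q = cmult_bounded[OF p \<open>cond r\<close> pr, unfolded \<rho>(2)]
      have "realizes A (e(x := n)) (\<tau> \<bullet> numeral_of A n) F"
        using realizes_AD[OF \<tau>] n(2) by (intro realizes_AI pole_app) auto
      from realizes_BD(3)[OF transfersD(3)[OF F empty_cond(1) this] _ m, of \<pi> q]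
      have "\<theta>F \<bullet> (\<tau> \<bullet> numeral_of A n) \<star> numeral_of A m \<triangleright> \<pi>"
        using \<pi>' \<pi>(1) q by simp
      then have "\<gamma> \<bullet> \<tau> \<star> numeral_of A m \<triangleright> numeral_of A n \<triangleright> \<pi>"
        by - (rule pole_app, rule \<gamma>(2), (use m n(2) \<pi>(2) in simp_all))
      then have "fapply ext_numerals n \<star>
          numeral_of A m \<triangleright> \<phi> \<triangleright> (\<gamma> \<bullet> \<tau>) \<triangleright> numeral_of A empty \<triangleright> \<pi>"
        using m n(2) \<pi>(2) by (intro ext_numeral_store \<phi>(2)) simp_all
      then show "\<theta> \<bullet> \<tau> \<star> numeral_of A m \<triangleright> \<rho>"
        unfolding \<rho>(1) by - (rule pole_app, rule \<theta>(2), (use m n(2) \<pi>(2) in simp_all))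
    qed (use p in simp_all)
  next
    fix e \<tau> p m
    assume p: "p \<noteq> z" and m: "m \<epsilon> omega" and pm: "subset_of (dom p) m"
      and \<tau>: "realizes B e (opair \<tau> p) (ForallInt x F)"
    note [simp] = realizes_BD(1,2)[OF \<tau>]
    show "realizes A e (\<theta>' \<bullet> numeral_of A m \<bullet> \<tau>) (ForallInt x F)"
    proof (rule realizes_AI)
      fix \<rho> assume "\<rho> \<in> falsity A e (ForallInt x F)"
      then obtain k \<pi> where \<rho>: "\<rho> = numeral_of A k \<triangleright> \<pi>" and k: "k \<epsilon> omega"
        and \<pi>: "\<pi> \<in> falsity A (e(x := k)) F" by auto
      have [simp]: "stk \<pi>"
        using falsity_stacks[OF operations_func(1) trm_instructions(1,3,4,5) operations_func(2) \<pi>] .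
      \<comment> \<open>Extended integers carry the condition \<open>empty\<close>, so applying
        \<open>\<tau>\<close> to one leaves the condition \<open>p\<close> unchanged.\<close>
      have "realizes B (e(x := k)) (opair (iC A \<bullet> \<tau> \<bullet> fapply ext_numerals k) p) F"
      proof (rule realizes_BI)
        fix \<pi> q n
        assume \<pi>: "opair \<pi> q \<in> falsity B (e(x := k)) F" "stk \<pi>" "cond q" and n: "n \<epsilon> omega"
          and pq: "cmult z p q \<noteq> z" "subset_of (dom (cmult z p q)) n"
        have "push B (numeral_of B k) (opair \<pi> q) \<in> falsity B e (ForallInt x F)"
          using k \<pi>(1) by auto
        then have "opair (fapply ext_numerals k \<triangleright> \<pi>) q \<in> falsity B e (ForallInt x F)"
          using k \<pi>(2,3) by (simp add: push_ext(2) numeral_of_B)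
        then have "\<tau> \<star> numeral_of A n \<triangleright> fapply ext_numerals k \<triangleright> \<pi>"
          using realizes_BD(3)[OF \<tau> _ n pq] by blast
        then show "iC A \<bullet> \<tau> \<bullet> fapply ext_numerals k \<star> numeral_of A n \<triangleright> \<pi>"
          using k n \<pi>(2) by (intro pole_app pole_C) simp_all
      qed (use k in simp_all)
      from realizes_AD[OF transfersD(4)[OF F this p m pm]]
      have "\<theta>F' \<bullet> numeral_of A m \<bullet> (iC A \<bullet> \<tau> \<bullet> fapply ext_numerals k) \<star> \<pi>" using \<pi> by blast
      then have "\<gamma>' \<bullet> numeral_of A m \<bullet> \<tau> \<star> fapply ext_numerals k \<triangleright> \<pi>"
        by - (rule pole_app, rule pole_app, rule \<gamma>'(2), (use k m in simp_all))
      then have "numeral_of A k \<star>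
          \<phi>' \<triangleright> (\<gamma>' \<bullet> numeral_of A m \<bullet> \<tau>) \<triangleright> fapply ext_numerals empty \<triangleright> \<pi>"
        using k m by (intro numeral_store \<phi>'(2)) simp_all
      then show "\<theta>' \<bullet> numeral_of A m \<bullet> \<tau> \<star> \<rho>"
        unfolding \<rho> by - (rule pole_app, rule pole_app, rule \<theta>'(2), (use k m in simp_all))
    qed (use m in simp)
  qed
  then show ?thesis by blast
qed

lemma transfers_elementary: "\<exists>\<theta> \<theta>'. transfers F \<theta> \<theta>'"
proof (induction F)
  case Top
  show ?case using transfers_Top by blast
next
  case Bot
  show ?case using transfers_Bot by blast
next
  case (EqImp t u F)
  then show ?case using transfers_EqImp by blast
next
  case (Univ x F)
  then show ?case using transfers_Univ by blast
next
  case (Imp F G)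
  then obtain \<theta>F \<theta>F' \<theta>G \<theta>G' where "transfers F \<theta>F \<theta>F'" "transfers G \<theta>G \<theta>G'" by auto
  then show ?case by (rule transfers_Imp)
next
  case (ForallInt x F)
  then obtain \<theta>F \<theta>F' where "transfers F \<theta>F \<theta>F'" by auto
  then show ?case by (rule transfers_ForallInt)
qed

lemma realized_iff: "realized A F \<longleftrightarrow> realized B F"
proof -
  obtain \<theta> \<theta>' where F: "transfers F \<theta> \<theta>'" using transfers_elementary by blast
  show ?thesis
  proof
    assume "realized A F"
    then obtain \<tau> where \<tau>: "prf \<tau>" "\<And>e. realizes A e \<tau> F" unfolding realized_def by blast
    then have "opair (\<theta> \<bullet> \<tau>) empty \<epsilon> QP B" using transfersD(1)[OF F] by (simp add: in_QP_ext)
    moreover have "realizes B e (opair (\<theta> \<bullet> \<tau>) empty) F" for e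
      using transfersD(3)[OF F empty_cond(1)] \<tau>(2) by blast
    ultimately show "realized B F" unfolding realized_def by blast
  next
    assume "realized B F"
    then obtain \<tau> where \<tau>: "prf \<tau>" "\<And>e. realizes B e (opair \<tau> empty) F"
      unfolding realized_def in_QP_ext by blast
    \<comment> \<open>Proof-like terms of the extended algebra have condition \<open>empty\<close>,
      whose length is bounded by the integer 0.\<close>
    have "prf (\<theta>' \<bullet> numeral_of A empty \<bullet> \<tau>)"
      using transfersD(2)[OF F] \<tau>(1) by (simp add: A_numeral_empty)
    moreover have "realizes A e (\<theta>' \<bullet> numeral_of A empty \<bullet> \<tau>) F" for e
      by (rule transfersD(4)[OF F \<tau>(2)]) (simp_all add: subset_of_def)
    ultimately show "realized A F" unfolding realized_def by blast
  qed
qed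

end

theorem theorem39:
  fixes mem :: "'m \<Rightarrow> 'm \<Rightarrow> bool"
    and A :: "'m algebra"
    and \<kappa> z b :: 'm
    and F :: "'m elementary"
  assumes "set_structure.ZF mem"
    and "set_structure.V_eq_L mem"
    and "set_structure.realizability_algebra mem A"
    and "set_structure.coherent mem A"
    and "set_structure.infinite_cardinal mem \<kappa>"
    and "set_structure.cardinal_le mem (set_structure.union mem (Terms A) (Stacks A)) \<kappa>"
    and "\<not> mem z (set_structure.fin_seqs mem \<kappa>)"
    and "set_structure.extended_pole mem A \<kappa> z b"
    and "set_structure.closed_elementary mem F"
  shows "set_structure.realized mem A F \<longleftrightarrow>
    set_structure.realized mem (set_structure.extended_algebra mem A \<kappa> z b) F"
proof -
  interpret forcing_extension mem A \<kappa> z b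
    by unfold_locales (fact assms)+
  show ?thesis by (rule realized_iff)
qed

end
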